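(* Let $G$ be a non-discrete, locally compact group, and let $\omega$ be a weight on $G$. Then $L^1(G,\omega)$ has no finitely-generated, closed, maximal left ideals, and no finitely-generated, closed left ideals of finite codimension.
   Context: A weight on a locally compact group $G$ with identity $e$ is a Borel function $\omega:G\to[1,\infty)$, bounded on compact sets, with $\omega(uv)\le\omega(u)\omega(v)$ for all $u,v\in G$ and $\omega(e)=1$. With $m$ left Haar measure on $G$, $L^1(G,\omega)=\{f\in L^1(G):\|f\|_\omega=\int_G|f(t)|\omega(t)\,\mathrm{d}m(t)<\infty\}$, a Banach algebra under convolution. For an algebra $A$, $A^\sharp$ denotes its conditional unitisation ($A^\sharp=A$ if $A$ is unital; otherwise $A^\sharp$ is $A$ with an identity adjoined). A left ideal $I$ of $A$ is finitely-generated if there exist $n\in\mathbb{N}$ and $x_1,\ldots,x_n\in A$ with $I=A^\sharp x_1+\cdots+A^\sharp x_n$ (purely algebraically, no closure is taken). *)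

theory Defs
  imports "HOL-Analysis.Analysis"
begin

text \<open>Groups are written additively: \<open>group_add\<close> is not assumed commutative, and
  \<open>topological_group_add\<close> is the library's class of (possibly non-abelian) topological groups.\<close>


section \<open>Complex algebras with a carrier\<close>

record 'a calgebra =
  carr :: "'a set"
  add :: "'a \<Rightarrow> 'a \<Rightarrow> 'a"
  zer :: 'a
  scale :: "complex \<Rightarrow> 'a \<Rightarrow> 'a"
  mul :: "'a \<Rightarrow> 'a \<Rightarrow> 'a"
  nrm :: "'a \<Rightarrow> real"

primrec alg_sum :: "'a calgebra \<Rightarrow> (nat \<Rightarrow> 'a) \<Rightarrow> nat \<Rightarrow> 'a" where
  "alg_sum A y 0 = zer A"
| "alg_sum A y (Suc n) = add A (alg_sum A y n) (y n)"

definition left_ideal :: "'a calgebra \<Rightarrow> 'a set \<Rightarrow> bool" where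
  "left_ideal A I \<longleftrightarrow>
     I \<subseteq> carr A \<and> zer A \<in> I \<and>
     (\<forall>x\<in>I. \<forall>y\<in>I. add A x y \<in> I) \<and>
     (\<forall>c. \<forall>x\<in>I. scale A c x \<in> I) \<and>
     (\<forall>a\<in>carr A. \<forall>x\<in>I. mul A a x \<in> I)"

definition maximal_left_ideal :: "'a calgebra \<Rightarrow> 'a set \<Rightarrow> bool" where
  "maximal_left_ideal A I \<longleftrightarrow>
     left_ideal A I \<and> I \<noteq> carr A \<and>
     (\<forall>J. left_ideal A J \<and> I \<subseteq> J \<longrightarrow> J = I \<or> J = carr A)"

definition unital :: "'a calgebra \<Rightarrow> bool" where
  "unital A \<longleftrightarrow> (\<exists>e\<in>carr A. \<forall>a\<in>carr A. mul A e a = a \<and> mul A a e = a)"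

text \<open>The pair \<open>(a, c)\<close> stands for \<open>a + c1\<close>, where \<open>1\<close> is the adjoined identity; if \<open>A\<close> is
  already unital then \<open>c = 0\<close>, so that \<open>A\<^sup>\<sharp> = A\<close>. Since \<open>A\<close> is an ideal of \<open>A\<^sup>\<sharp>\<close>, the product
  of an element of \<open>A\<^sup>\<sharp>\<close> and an element of \<open>A\<close> lies in \<open>A\<close>.\<close>

definition cond_unitisation :: "'a calgebra \<Rightarrow> ('a \<times> complex) set" where
  "cond_unitisation A = (if unital A then carr A \<times> {0} else carr A \<times> UNIV)"

definition cu_mul :: "'a calgebra \<Rightarrow> 'a \<times> complex \<Rightarrow> 'a \<Rightarrow> 'a" where
  "cu_mul A u x = add A (mul A (fst u) x) (scale A (snd u) x)"

definition finitely_generated :: "'a calgebra \<Rightarrow> 'a set \<Rightarrow> bool" where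
  "finitely_generated A I \<longleftrightarrow>
     (\<exists>n. \<exists>x :: nat \<Rightarrow> 'a. (\<forall>i<n. x i \<in> carr A) \<and>
        I = {alg_sum A (\<lambda>i. cu_mul A (u i) (x i)) n | u. \<forall>i<n. u i \<in> cond_unitisation A})"

text \<open>The cosets of \<open>b 0, \<dots>, b (n - 1)\<close> span the quotient vector space \<open>A / I\<close>.\<close>

definition finite_codimension :: "'a calgebra \<Rightarrow> 'a set \<Rightarrow> bool" where
  "finite_codimension A I \<longleftrightarrow>
     (\<exists>n. \<exists>b :: nat \<Rightarrow> 'a. (\<forall>i<n. b i \<in> carr A) \<and>
        (\<forall>a\<in>carr A. \<exists>x\<in>I. \<exists>c. a = add A x (alg_sum A (\<lambda>i. scale A (c i) (b i)) n)))"

definition norm_topology :: "'a calgebra \<Rightarrow> 'a topology" where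
  "norm_topology A =
     Metric_space.mtopology (carr A) (\<lambda>x y. nrm A (add A x (scale A (-1) y)))"


section \<open>Haar measures and weights\<close>

text \<open>A left Haar measure is a nonzero left-invariant Radon measure on the Borel sets; no
  \<open>\<sigma>\<close>-finiteness or second countability is assumed.\<close>

definition left_haar_measure :: "'g::{topological_group_add, t2_space} measure \<Rightarrow> bool" where
  "left_haar_measure m \<longleftrightarrow>
     sets m = sets borel \<and> emeasure m UNIV \<noteq> 0 \<and>
     (\<forall>a. \<forall>E\<in>sets borel. emeasure m ((+) a ` E) = emeasure m E) \<and>
     (\<forall>K. compact K \<longrightarrow> emeasure m K < \<infinity>) \<and>
     (\<forall>E\<in>sets borel. emeasure m E = (INF U\<in>{U. open U \<and> E \<subseteq> U}. emeasure m U)) \<and>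
     (\<forall>U. open U \<longrightarrow> emeasure m U = (SUP K\<in>{K. compact K \<and> K \<subseteq> U}. emeasure m K))"

definition weight :: "('g::{topological_group_add, t2_space} \<Rightarrow> real) \<Rightarrow> bool" where
  "weight \<omega> \<longleftrightarrow>
     \<omega> \<in> borel_measurable borel \<and> (\<forall>u. 1 \<le> \<omega> u) \<and>
     (\<forall>K. compact K \<longrightarrow> bounded (\<omega> ` K)) \<and>
     (\<forall>u v. \<omega> (u + v) \<le> \<omega> u * \<omega> v) \<and> \<omega> 0 = 1"


section \<open>Weighted convolution algebras\<close>

definition L1w_funs ::
    "'g::{topological_group_add, t2_space} measure \<Rightarrow> ('g \<Rightarrow> real) \<Rightarrow> ('g \<Rightarrow> complex) set" where
  "L1w_funs m \<omega> = {f. integrable m f \<and> integrable m (\<lambda>t. norm (f t) * \<omega> t)}"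

definition L1w_rel ::
    "'g::{topological_group_add, t2_space} measure \<Rightarrow> ('g \<Rightarrow> real) \<Rightarrow>
      (('g \<Rightarrow> complex) \<times> ('g \<Rightarrow> complex)) set" where
  "L1w_rel m \<omega> = {(f, g). f \<in> L1w_funs m \<omega> \<and> g \<in> L1w_funs m \<omega> \<and> (AE t in m. f t = g t)}"

text \<open>In multiplicative notation this is \<open>(f * g)(s) = \<integral> f(t) g(t\<inverse>s) dm(t)\<close>. It is the
  ordinary convolution for almost every \<open>s\<close>; on the null set where the integrand is not
  integrable, the Bochner integral takes the value \<open>0\<close>.\<close>

definition convolution ::
    "'g::{topological_group_add, t2_space} measure \<Rightarrow> ('g \<Rightarrow> complex) \<Rightarrow> ('g \<Rightarrow> complex) \<Rightarrow>
      'g \<Rightarrow> complex" where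
  "convolution m f g s = (LINT t|m. f t * g (- t + s))"

text \<open>The elements are classes of functions modulo equality almost everywhere. The operations
  are induced by those on representatives.\<close>

definition L1w ::
    "'g::{topological_group_add, t2_space} measure \<Rightarrow> ('g \<Rightarrow> real) \<Rightarrow>
      ('g \<Rightarrow> complex) set calgebra" where
  "L1w m \<omega> =
     \<lparr> carr = L1w_funs m \<omega> // L1w_rel m \<omega>,
       add = (\<lambda>X Y. \<Union>f\<in>X. \<Union>g\<in>Y. L1w_rel m \<omega> `` {\<lambda>t. f t + g t}),
       zer = L1w_rel m \<omega> `` {\<lambda>t. 0},
       scale = (\<lambda>c X. \<Union>f\<in>X. L1w_rel m \<omega> `` {\<lambda>t. c * f t}),
       mul = (\<lambda>X Y. \<Union>f\<in>X. \<Union>g\<in>Y. L1w_rel m \<omega> `` {convolution m f g}),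
       nrm = (\<lambda>X. the_elem ((\<lambda>f. LINT t|m. norm (f t) * \<omega> t) ` X)) \<rparr>"

end

theory Submission
  imports Defs
begin

text \<open>The idea is that in the weighted algebra of a non-discrete group every finite set lies in a
  proper left ideal (\<open>finite_subset_in_proper_left_ideal\<close>), so the algebra is not finitely
  generated as a left ideal over itself. If \<open>I\<close> is a finitely generated left ideal that is maximal,
  then adding one element outside \<open>I\<close> to the generators would generate the whole algebra; if \<open>I\<close>
  has finite codimension, adding a spanning set of the quotient would. Both are impossible.

  The proper left ideal comes from uniform integrability. For a function \<open>\<phi>\<close> consider all \<open>f\<close> with
  \<open>\<integral>\<^sub>E \<bar>f\<bar> \<le> C * \<phi> (m E)\<close> for some constant \<open>C\<close> and all Borel sets \<open>E\<close>. This condition is stable under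
  convolution from the left, because \<open>\<integral>\<^sub>E \<bar>b * f\<bar>\<close> is at most the integral of
  \<open>\<bar>b t\<bar> * \<integral>\<^sub>F \<bar>f\<bar>\<close> over \<open>t\<close>, where \<open>F\<close> is the translate of \<open>E\<close> by \<open>- t\<close> and has the same measure as
  \<open>E\<close>. Given finitely many \<open>f\<close>, let \<open>\<phi> \<delta>\<close> be the sum of their largest masses on sets of measure
  at most \<open>\<delta>\<close>; all of them belong to the ideal, and \<open>\<phi> \<delta>\<close> tends to \<open>0\<close> with \<open>\<delta>\<close>. As the group is
  not discrete, there are sets of arbitrarily small positive measure, and concentrating summable
  masses on a rapidly shrinking sequence of them gives an element outside the ideal
  (\<open>dominated_ideal_proper\<close>).

  The group need not be second countable or \<open>\<sigma>\<close>-compact, so the facts about convolution that are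
  used here (measurability, submultiplicativity of the norms, independence of representatives) need
  a version of Tonelli's theorem for Borel functions on the topological product
  (\<open>tonelli_finite_inner_regular\<close>). It is applied to finite measures that have an integrable density
  with respect to Haar measure: these are inner regular, and integrable functions live on
  \<open>\<sigma>\<close>-compact sets up to null sets.\<close>

section \<open>Tonelli's theorem for inner regular measures\<close>

text \<open>Without second countability the Borel sets of a product space need not belong to the product
  \<open>\<sigma>\<close>-algebra, so Tonelli's theorem for \<open>\<Otimes>\<^sub>M\<close> says nothing about a function such as
  \<open>(s, t) \<mapsto> f (- t + s)\<close>. Approximation of open sets by compact sets takes the place of
  countability.\<close>
definition finite_inner_regular :: "'a::topological_space measure \<Rightarrow> bool" where
  "finite_inner_regular \<mu> \<longleftrightarrow>
     sets \<mu> = sets borel \<and> emeasure \<mu> UNIV < \<infinity> \<and>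
     (\<forall>U. open U \<longrightarrow> (\<forall>e>0. \<exists>K. compact K \<and> K \<subseteq> U \<and>
        emeasure \<mu> U \<le> emeasure \<mu> K + ennreal e))"

lemma space_eq_UNIV_of_sets_borel: "sets \<mu> = sets borel \<Longrightarrow> space \<mu> = UNIV"
  by (metis sets_eq_imp_space_eq space_borel)

lemma measurable_Pair_section:
  assumes "E \<in> sets (borel :: ('a::topological_space \<times> 'b::topological_space) measure)"
  shows "Pair x -` E \<in> sets borel" "(\<lambda>x. (x, y)) -` E \<in> sets borel"
proof -
  have "Pair x \<in> borel_measurable (borel :: 'b measure)"
    by (intro borel_measurable_continuous_onI continuous_intros)
  from measurable_sets[OF this assms] show "Pair x -` E \<in> sets borel" by simp
  have "(\<lambda>x. (x, y)) \<in> borel_measurable (borel :: 'a measure)"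
    by (intro borel_measurable_continuous_onI continuous_intros)
  from measurable_sets[OF this assms] show "(\<lambda>x. (x, y)) -` E \<in> sets borel" by simp
qed

lemma open_section:
  assumes "open (W :: ('a::topological_space \<times> 'b::topological_space) set)"
  shows "open (Pair x -` W)"
  by (rule open_vimage[OF assms]) (intro continuous_intros)

text \<open>The tube lemma, applied to a compact subset of the section over \<open>x\<close> that is large in measure.\<close>
lemma rectangle_inside_open:
  fixes \<nu> :: "'b::t2_space measure" and W :: "('a::topological_space \<times> 'b) set"
  assumes \<nu>: "finite_inner_regular \<nu>" and W: "open W" and less: "\<alpha> < emeasure \<nu> (Pair x -` W)"
  shows "\<exists>N L. open N \<and> x \<in> N \<and> compact L \<and> \<alpha> < emeasure \<nu> L \<and> N \<times> L \<subseteq> W"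
proof -
  have "\<exists>e>0. \<alpha> + ennreal e < emeasure \<nu> (Pair x -` W)"
  proof -
    from less obtain d where d: "\<alpha> < d" "d < emeasure \<nu> (Pair x -` W)"
      using dense by blast
    then have fin: "\<alpha> \<noteq> top" "d \<noteq> top"
      by (metis top.extremum_strict)+
    define e where "e = enn2real d - enn2real \<alpha>"
    have "enn2real \<alpha> < enn2real d" using d(1) fin
      by (metis enn2real_nonneg ennreal_enn2real_if ennreal_less_iff)
    then have "e > 0" "ennreal (enn2real \<alpha> + e) = d"
      using fin by (auto simp: e_def ennreal_enn2real_if)
    then show ?thesis using d fin
      by (metis enn2real_nonneg ennreal_enn2real_if ennreal_plus less_imp_le)
  qed
  then obtain e where e: "e > 0" "\<alpha> + ennreal e < emeasure \<nu> (Pair x -` W)" by blast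
  obtain L where L: "compact L" "L \<subseteq> Pair x -` W"
      "emeasure \<nu> (Pair x -` W) \<le> emeasure \<nu> L + ennreal e"
    using \<nu> open_section[OF W] e(1) unfolding finite_inner_regular_def by meson
  have "\<alpha> + ennreal e < emeasure \<nu> L + ennreal e"
    using e(2) L(3) by (rule less_le_trans)
  then have "\<alpha> < emeasure \<nu> L"
    by (metis add.commute ennreal_add_left_cancel_less)
  moreover obtain N where "x \<in> N" "open N" "N \<times> L \<subseteq> W"
  proof -
    have "{x} \<times> L \<subseteq> W" using L(2) by auto
    from Elementary_Topology.tube_lemma[OF L(1) W this] show ?thesis using that by blast
  qed
  ultimately show ?thesis using L(1) by blast
qed

text \<open>The measure of the section of an open set is a lower semicontinuous function of the base point.
  This is where sections of arbitrary open sets become Borel measurable.\<close>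
lemma open_superlevel_section:
  fixes \<nu> :: "'b::t2_space measure" and W :: "('a::topological_space \<times> 'b) set"
  assumes \<nu>: "finite_inner_regular \<nu>" and W: "open W"
  shows "open {x. \<alpha> < emeasure \<nu> (Pair x -` W)}"
proof (subst open_subopen, intro ballI)
  fix x assume "x \<in> {x. \<alpha> < emeasure \<nu> (Pair x -` W)}"
  then obtain N L where NL: "open N" "x \<in> N" "compact L" "\<alpha> < emeasure \<nu> L" "N \<times> L \<subseteq> W"
    using rectangle_inside_open[OF \<nu> W, of \<alpha> x] by auto
  have "\<alpha> < emeasure \<nu> (Pair z -` W)" if "z \<in> N" for z
  proof -
    have "emeasure \<nu> L \<le> emeasure \<nu> (Pair z -` W)"
      using NL that open_section[OF W, of z] \<nu>
      by (intro emeasure_mono) (auto simp: finite_inner_regular_def)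
    with NL(4) show ?thesis by (rule less_le_trans)
  qed
  then show "\<exists>T. open T \<and> x \<in> T \<and> T \<subseteq> {x. \<alpha> < emeasure \<nu> (Pair x -` W)}"
    using NL by blast
qed

text \<open>The next two lemmas are the two sides of the discrete layer cake formula: counting the multiples
  of \<open>c\<close> below \<open>r\<close> gives \<open>r / c\<close> up to an error of \<open>1\<close>.\<close>
lemma layer_count_le:
  fixes c r :: real
  assumes "c > 0" "r \<ge> 0" "S \<subseteq> {1..n}" "\<And>k. k \<in> S \<Longrightarrow> real k * c < r"
  shows "c * real (card S) \<le> r"
proof (cases "S = {}")
  case False
  have fin: "finite S" using assms(3) finite_subset by blast
  have "S \<subseteq> {1..Max S}" using assms(3) fin by auto
  then have "card S \<le> Max S" by (metis card_atLeastAtMost card_mono diff_Suc_1 finite_atLeastAtMost)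
  then have "real (card S) * c \<le> real (Max S) * c" using assms(1) by simp
  also have "\<dots> < r" using assms(4) Max_in[OF fin False] by blast
  finally show ?thesis by (simp add: mult.commute)
qed (use assms in auto)

lemma le_layer_count:
  fixes c r :: real
  assumes "c > 0" "r \<le> c * (real n + 1)"
  shows "r \<le> c + c * real (card {k\<in>{1..n}. real k * c < r})"
proof (rule ccontr)
  define S where "S = {k\<in>{1..n}. real k * c < r}"
  define N where "N = card S"
  assume "\<not> ?thesis"
  then have r: "(real N + 1) * c < r" by (simp add: algebra_simps N_def S_def)
  have "N < n"
  proof (rule ccontr)
    assume "\<not> N < n"
    then have "(real n + 1) * c \<le> (real N + 1) * c"
      using assms(1) by (intro mult_right_mono) auto
    with r assms(2) show False by (simp add: mult.commute)
  qed
  moreover have "real k * c < r" if "k \<le> N + 1" for k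
  proof -
    have "real k * c \<le> (real N + 1) * c" using that assms(1) by (intro mult_right_mono) auto
    with r show ?thesis by linarith
  qed
  ultimately have "{1..N + 1} \<subseteq> S" by (auto simp: S_def)
  then have "card {1..N + 1} \<le> N" unfolding N_def by (intro card_mono) (auto simp: S_def)
  then show False by simp
qed

text \<open>An open \<open>W\<close> is, up to a small error in the first iterated integral, a finite union of measurable
  rectangles contained in \<open>W\<close>, and for such a union the two iterated integrals agree by the usual
  theorem. To find the union, the measure of the section of \<open>W\<close> is cut into finitely many layers
  of height \<open>c\<close>; each superlevel set is open, so a compact set exhausts it up to a small error,
  and finitely many rectangles inside \<open>W\<close> cover that compact set.\<close>
lemma emeasure_open_le_swapped:
  fixes \<mu> :: "'a::t2_space measure" and \<nu> :: "'b::t2_space measure"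
  assumes \<mu>: "finite_inner_regular \<mu>" and \<nu>: "finite_inner_regular \<nu>"
    and W: "open (W :: ('a \<times> 'b) set)"
    and meas: "(\<lambda>y. emeasure \<mu> ((\<lambda>x. (x, y)) -` W)) \<in> borel_measurable borel"
  shows "(\<integral>\<^sup>+x. emeasure \<nu> (Pair x -` W) \<partial>\<mu>) \<le> (\<integral>\<^sup>+y. emeasure \<mu> ((\<lambda>x. (x, y)) -` W) \<partial>\<nu>)"
    (is "_ \<le> ?R")
proof (rule ennreal_le_epsilon)
  fix \<epsilon> :: real assume "\<epsilon> > 0"
  have s[measurable_cong, simp]: "sets \<mu> = sets borel" "sets \<nu> = sets borel"
    using \<mu> \<nu> by (auto simp: finite_inner_regular_def)
  have sp[simp]: "space \<mu> = UNIV" "space \<nu> = UNIV"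
    using s(1,2)[THEN space_eq_UNIV_of_sets_borel] by auto
  interpret \<mu>: finite_measure \<mu> using \<mu> by (intro finite_measureI) (auto simp: finite_inner_regular_def)
  interpret \<nu>: finite_measure \<nu> using \<nu> by (intro finite_measureI) (auto simp: finite_inner_regular_def)
  interpret \<mu>\<nu>: pair_sigma_finite \<mu> \<nu> ..
  define M where "M = measure \<nu> UNIV"
  define M' where "M' = measure \<mu> UNIV"
  have M: "M \<ge> 0" "M' \<ge> 0" by (auto simp: M_def M'_def)
  obtain n :: nat where n: "(M + 1) * (M' + 1) / \<epsilon> < real n"
    using reals_Archimedean2 by blast
  \<comment> \<open>\<open>n + 1\<close> layers of height \<open>c\<close> reach above \<open>M\<close>, and the layers lost at the bottom and the
    compact approximations together cost at most \<open>c * M' + c\<close>.\<close>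
  define c where "c = (M + 1) / (real n + 1)"
  have c: "c > 0" "c * (real n + 1) = M + 1" using M by (auto simp: c_def field_simps)
  have err: "c * M' + c \<le> \<epsilon>"
  proof -
    have "(M + 1) * (M' + 1) < \<epsilon> * real n" using n \<open>\<epsilon> > 0\<close> by (simp add: field_simps)
    then have "(M + 1) * (M' + 1) \<le> \<epsilon> * (real n + 1)" using \<open>\<epsilon> > 0\<close> by (simp add: algebra_simps)
    then have "(M + 1) * (M' + 1) / (real n + 1) \<le> \<epsilon>" by (subst pos_divide_le_eq) auto
    then show ?thesis by (simp add: c_def ring_distribs add_divide_distrib)
  qed
  define h where "h x = measure \<nu> (Pair x -` W)" for x
  have h: "emeasure \<nu> (Pair x -` W) = ennreal (h x)" for x
    by (simp add: h_def \<nu>.emeasure_eq_measure)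
  have h0: "h x \<ge> 0" and hM: "h x \<le> M" for x
    by (auto simp: h_def M_def intro!: \<nu>.finite_measure_mono)
  define V where "V k = {x. real k * c < h x}" for k
  have V_alt: "V k = {x. ennreal (real k * c) < emeasure \<nu> (Pair x -` W)}" for k
    using c by (auto simp: V_def h ennreal_less_iff)
  have V_open: "open (V k)" for k
    unfolding V_alt by (rule open_superlevel_section[OF \<nu> W])
  have "\<exists>K. compact K \<and> K \<subseteq> V k \<and> emeasure \<mu> (V k) \<le> emeasure \<mu> K + ennreal (1 / (real n + 1))" for k
    using \<mu> V_open[of k] unfolding finite_inner_regular_def by auto
  then obtain K where K: "\<And>k. compact (K k)" "\<And>k. K k \<subseteq> V k"
     "\<And>k. emeasure \<mu> (V k) \<le> emeasure \<mu> (K k) + ennreal (1 / (real n + 1))" by metis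
  have "\<exists>T. finite T \<and> K k \<subseteq> \<Union>(fst ` T) \<and> (\<forall>N L. (N,L) \<in> T \<longrightarrow> open N \<and> compact L \<and> N \<times> L \<subseteq> W \<and>
          ennreal (real k * c) < emeasure \<nu> L)" for k
  proof -
    define C where "C = {(N,L). open N \<and> compact L \<and> N \<times> L \<subseteq> W \<and> ennreal (real k * c) < emeasure \<nu> L}"
    have "K k \<subseteq> (\<Union>p\<in>C. fst p)"
    proof
      fix x assume "x \<in> K k"
      then have "ennreal (real k * c) < emeasure \<nu> (Pair x -` W)" using K(2) V_alt by blast
      from rectangle_inside_open[OF \<nu> W this] show "x \<in> (\<Union>p\<in>C. fst p)"
        unfolding C_def by fastforce
    qed
    moreover have op: "open (fst p)" if "p \<in> C" for p using that by (auto simp: C_def)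
    ultimately obtain T where "T \<subseteq> C" "finite T" "K k \<subseteq> (\<Union>p\<in>T. fst p)"
      using compactE_image[OF K(1), of C fst k] op by metis
    moreover from this(1) have "\<forall>N L. (N,L) \<in> T \<longrightarrow> open N \<and> compact L \<and> N \<times> L \<subseteq> W \<and>
          ennreal (real k * c) < emeasure \<nu> L"
      by (auto simp: C_def)
    ultimately show ?thesis by (intro exI[of _ T]) simp
  qed
  then obtain T where T: "\<And>k. finite (T k)" "\<And>k. K k \<subseteq> \<Union>(fst ` T k)"
    "\<And>k N L. (N,L) \<in> T k \<Longrightarrow> open N \<and> compact L \<and> N \<times> L \<subseteq> W \<and> ennreal (real k * c) < emeasure \<nu> L"
    by metis
  define W' where "W' = (\<Union>k\<in>{1..n}. \<Union>(N,L)\<in>T k. N \<times> L)"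
  have W'_sub: "W' \<subseteq> W" using T(3) unfolding W'_def by blast
  have W'_sets: "W' \<in> sets (\<mu> \<Otimes>\<^sub>M \<nu>)"
  proof -
    have "N \<times> L \<in> sets (\<mu> \<Otimes>\<^sub>M \<nu>)" if "(N, L) \<in> T k" for k N L
      using T(3)[OF that] by (intro pair_measureI) (auto intro: borel_open borel_closed compact_imp_closed)
    then show ?thesis unfolding W'_def using T(1) by (intro sets.finite_UN) auto
  qed
  have W'_sec: "Pair x -` W' \<in> sets borel" "(\<lambda>x. (x, y)) -` W' \<in> sets borel" for x y
    using sets_Pair1[OF W'_sets] sets_Pair2[OF W'_sets] by auto
  have W_sec: "Pair x -` W \<in> sets borel" "(\<lambda>x. (x, y)) -` W \<in> sets borel" for x y
    using measurable_Pair_section[OF borel_open[OF W]] by auto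
  have card_eq: "(\<Sum>k\<in>{1..n}. indicator (X k) x) = ennreal (real (card {k\<in>{1..n}. x \<in> X k}))"
    for X :: "nat \<Rightarrow> 'a set" and x
  proof -
    have "(\<Sum>k\<in>{1..n}. indicator (X k) x :: ennreal) = (\<Sum>k\<in>{1..n}. ennreal (if x \<in> X k then 1 else 0))"
      by (intro sum.cong) (auto simp: indicator_def)
    also have "\<dots> = ennreal (\<Sum>k\<in>{1..n}. (if x \<in> X k then 1 else 0))" by (subst sum_ennreal) auto
    also have "(\<Sum>k\<in>{1..n}. (if x \<in> X k then 1 else 0 :: real)) = real (card {k\<in>{1..n}. x \<in> X k})"
      by (simp add: sum.If_cases Int_def)
    finally show ?thesis .
  qed
  have [measurable]: "V k \<in> sets borel" "K k \<in> sets borel" for k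
    using V_open K(1) by (auto intro: borel_closed compact_imp_closed)
  have lower: "ennreal c * (\<Sum>k\<in>{1..n}. indicator (K k) x) \<le> emeasure \<nu> (Pair x -` W')" for x
  proof -
    have "real k * c < measure \<nu> (Pair x -` W')" if k: "k \<in> {1..n}" "x \<in> K k" for k
    proof -
      from T(2)[of k] k(2) have "x \<in> \<Union>(fst ` T k)" by (rule subsetD)
      then obtain N L where NL: "(N, L) \<in> T k" "x \<in> N" by auto
      have "ennreal (real k * c) < emeasure \<nu> L" using T(3)[OF NL(1)] by simp
      also have "\<dots> \<le> emeasure \<nu> (Pair x -` W')"
      proof (intro emeasure_mono)
        have "N \<times> L \<subseteq> W'" using NL(1) k(1) unfolding W'_def by blast
        then show "L \<subseteq> Pair x -` W'" using NL(2) by auto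
      qed (use W'_sec in auto)
      finally show ?thesis using c(1) by (simp add: \<nu>.emeasure_eq_measure ennreal_less_iff)
    qed
    then have "c * real (card {k\<in>{1..n}. x \<in> K k}) \<le> measure \<nu> (Pair x -` W')"
      using c(1) by (intro layer_count_le[where n = n]) auto
    then show ?thesis unfolding card_eq
      using c(1) by (simp add: \<nu>.emeasure_eq_measure ennreal_mult'[symmetric] ennreal_leI del: ennreal_of_nat_eq_real_of_nat)
  qed
  have upper: "emeasure \<nu> (Pair x -` W) \<le> ennreal c + ennreal c * (\<Sum>k\<in>{1..n}. indicator (V k) x)" for x
  proof -
    have "h x \<le> c + c * real (card {k\<in>{1..n}. x \<in> V k})"
      using le_layer_count[of c "h x" n] c hM[of x] by (simp add: V_def)
    then show ?thesis unfolding card_eq h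
      using c(1) by (simp add: ennreal_mult'[symmetric] ennreal_plus[symmetric] ennreal_leI del: ennreal_plus)
  qed
  have "(\<integral>\<^sup>+x. emeasure \<nu> (Pair x -` W) \<partial>\<mu>) \<le> (\<integral>\<^sup>+x. ennreal c + ennreal c * (\<Sum>k\<in>{1..n}. indicator (V k) x) \<partial>\<mu>)"
    by (intro nn_integral_mono upper)
  also have "\<dots> = ennreal c * ennreal M' + ennreal c * (\<Sum>k\<in>{1..n}. emeasure \<mu> (V k))"
    by (simp add: nn_integral_add nn_integral_cmult nn_integral_sum M'_def \<mu>.emeasure_eq_measure)
  also have "\<dots> \<le> ennreal c * ennreal M' + ennreal c * (\<Sum>k\<in>{1..n}. emeasure \<mu> (K k) + ennreal (1 / (real n + 1)))"
    by (intro add_left_mono mult_left_mono sum_mono K) auto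
  also have "\<dots> = ennreal c * (\<Sum>k\<in>{1..n}. emeasure \<mu> (K k)) + ennreal (c * M' + c * real n * (1 / (real n + 1)))"
    using c(1) M by (simp add: sum.distrib ennreal_of_nat_eq_real_of_nat ennreal_mult'[symmetric] ring_distribs ennreal_plus add_ac mult_ac)
  also have "\<dots> \<le> ennreal c * (\<Sum>k\<in>{1..n}. emeasure \<mu> (K k)) + ennreal \<epsilon>"
  proof -
    have "c * real n * (1 / (real n + 1)) \<le> c" using c(1) by (simp add: field_simps)
    then show ?thesis using err by (intro add_left_mono ennreal_leI) linarith
  qed
  also have "ennreal c * (\<Sum>k\<in>{1..n}. emeasure \<mu> (K k)) = (\<integral>\<^sup>+x. ennreal c * (\<Sum>k\<in>{1..n}. indicator (K k) x) \<partial>\<mu>)"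
    by (simp add: nn_integral_cmult nn_integral_sum)
  also have "\<dots> \<le> (\<integral>\<^sup>+x. emeasure \<nu> (Pair x -` W') \<partial>\<mu>)" by (intro nn_integral_mono lower)
  also have "\<dots> = emeasure (\<mu> \<Otimes>\<^sub>M \<nu>) W'" by (simp add: \<nu>.emeasure_pair_measure_alt[OF W'_sets])
  also have "\<dots> = (\<integral>\<^sup>+y. emeasure \<mu> ((\<lambda>x. (x, y)) -` W') \<partial>\<nu>)" by (rule \<mu>\<nu>.emeasure_pair_measure_alt2[OF W'_sets])
  also have "\<dots> \<le> ?R" using W'_sub W_sec by (intro nn_integral_mono emeasure_mono) auto
  finally show "(\<integral>\<^sup>+x. emeasure \<nu> (Pair x -` W) \<partial>\<mu>) \<le> ?R + ennreal \<epsilon>" by (simp add: add_right_mono)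
qed

text \<open>Swapping the coordinates turns the inequality for open sets into an equality; open sets are
  closed under intersection and generate the Borel sets, and since both measures are finite the
  class of good sets is closed under complements.\<close>
lemma tonelli_borel_set:
  fixes \<mu> :: "'a::t2_space measure" and \<nu> :: "'b::t2_space measure"
  assumes \<mu>: "finite_inner_regular \<mu>" and \<nu>: "finite_inner_regular \<nu>"
    and E: "E \<in> sets (borel :: ('a \<times> 'b) measure)"
  shows "(\<lambda>x. emeasure \<nu> (Pair x -` E)) \<in> borel_measurable borel \<and>
         (\<lambda>y. emeasure \<mu> ((\<lambda>x. (x, y)) -` E)) \<in> borel_measurable borel \<and>
         (\<integral>\<^sup>+x. emeasure \<nu> (Pair x -` E) \<partial>\<mu>) = (\<integral>\<^sup>+y. emeasure \<mu> ((\<lambda>x. (x, y)) -` E) \<partial>\<nu>)"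
    (is "?P E")
proof -
  have s[measurable_cong, simp]: "sets \<mu> = sets borel" "sets \<nu> = sets borel"
    using \<mu> \<nu> by (auto simp: finite_inner_regular_def)
  have sp[simp]: "space \<mu> = UNIV" "space \<nu> = UNIV"
    using s(1,2)[THEN space_eq_UNIV_of_sets_borel] by auto
  interpret \<mu>: finite_measure \<mu> using \<mu> by (intro finite_measureI) (auto simp: finite_inner_regular_def)
  interpret \<nu>: finite_measure \<nu> using \<nu> by (intro finite_measureI) (auto simp: finite_inner_regular_def)
  have mm: "borel_measurable \<mu> = borel_measurable (borel :: 'a measure)"
           "borel_measurable \<nu> = borel_measurable (borel :: 'b measure)"
    by (auto intro: measurable_cong_sets)
  have gen: "sets (borel :: ('a \<times> 'b) measure) = sigma_sets UNIV {S. open S}"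
    by (simp add: borel_def)
  have "E \<in> sigma_sets UNIV {S :: ('a \<times> 'b) set. open S}" using E gen by simp
  then show ?thesis
  proof (induction E rule: sigma_sets_induct_disjoint[rotated 2, consumes 1, case_names basic empty compl union stable sub])
    case stable
    then show ?case by (auto simp: Int_stable_def)
  next
    case sub
    then show ?case by auto
  next
    case (basic W)
    then have W: "open W" by simp
    have m1: "(\<lambda>x. emeasure \<nu> (Pair x -` W)) \<in> borel_measurable borel"
      by (rule borel_measurableI_greater) (auto intro!: borel_open open_superlevel_section[OF \<nu> W])
    have W': "open (prod.swap -` W)"
      by (rule open_vimage[OF W]) (auto simp: prod.swap_def intro!: continuous_intros)
    have sw: "(\<lambda>x. (x, y)) -` W = Pair y -` (prod.swap -` W)"
             "Pair x -` W = (\<lambda>y. (y, x)) -` (prod.swap -` W)" for x y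
      by auto
    have m2: "(\<lambda>y. emeasure \<mu> ((\<lambda>x. (x, y)) -` W)) \<in> borel_measurable borel"
      unfolding sw by (rule borel_measurableI_greater) (auto intro!: borel_open open_superlevel_section[OF \<mu> W'])
    show ?case
      using m1 m2 emeasure_open_le_swapped[OF \<mu> \<nu> W m2]
        emeasure_open_le_swapped[OF \<nu> \<mu> W'] sw by (auto intro!: antisym)
  next
    case empty
    then show ?case by simp
  next
    case (compl E)
    then have "E \<in> sets borel" by (simp add: gen)
    note sec = measurable_Pair_section[OF this]
    have eq: "emeasure \<nu> (Pair x -` (UNIV - E)) = emeasure \<nu> UNIV - emeasure \<nu> (Pair x -` E)"
      "emeasure \<mu> ((\<lambda>x. (x, y)) -` (UNIV - E)) = emeasure \<mu> UNIV - emeasure \<mu> ((\<lambda>x. (x, y)) -` E)" for x y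
      using emeasure_compl[of "Pair x -` E" \<nu>] emeasure_compl[of "(\<lambda>x. (x, y)) -` E" \<mu>] sec
      by (auto simp: vimage_Diff Compl_eq_Diff_UNIV[symmetric] vimage_Compl)
    have fin: "(\<integral>\<^sup>+x. emeasure \<nu> (Pair x -` E) \<partial>\<mu>) < \<infinity>"
    proof -
      have "(\<integral>\<^sup>+x. emeasure \<nu> (Pair x -` E) \<partial>\<mu>) \<le> (\<integral>\<^sup>+x. emeasure \<nu> UNIV \<partial>\<mu>)"
        by (intro nn_integral_mono emeasure_mono) auto
      also have "\<dots> < \<infinity>" using \<mu> \<nu> by (simp add: ennreal_mult_less_top finite_inner_regular_def)
      finally show ?thesis .
    qed
    have "(\<integral>\<^sup>+x. emeasure \<nu> UNIV - emeasure \<nu> (Pair x -` E) \<partial>\<mu>)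
        = (\<integral>\<^sup>+x. emeasure \<nu> UNIV \<partial>\<mu>) - (\<integral>\<^sup>+x. emeasure \<nu> (Pair x -` E) \<partial>\<mu>)"
      using compl fin by (intro nn_integral_diff) (auto simp: mm intro!: AE_I2 emeasure_mono)
    also have "\<dots> = (\<integral>\<^sup>+y. emeasure \<mu> UNIV \<partial>\<nu>) - (\<integral>\<^sup>+y. emeasure \<mu> ((\<lambda>x. (x, y)) -` E) \<partial>\<nu>)"
      using compl by (simp add: mult.commute)
    also have "\<dots> = (\<integral>\<^sup>+y. emeasure \<mu> UNIV - emeasure \<mu> ((\<lambda>x. (x, y)) -` E) \<partial>\<nu>)"
      using compl fin by (intro nn_integral_diff[symmetric]) (auto simp: mm intro!: AE_I2 emeasure_mono)
    finally show ?case using compl unfolding eq by auto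
  next
    case (union A)
    then have A: "\<And>i. A i \<in> sets borel" by (auto simp: gen)
    note sec = measurable_Pair_section[OF A]
    have eq: "emeasure \<nu> (Pair x -` (\<Union>i. A i)) = (\<Sum>i. emeasure \<nu> (Pair x -` A i))"
      "emeasure \<mu> ((\<lambda>x. (x, y)) -` (\<Union>i. A i)) = (\<Sum>i. emeasure \<mu> ((\<lambda>x. (x, y)) -` A i))" for x y
    proof -
      have "disjoint_family (\<lambda>i. Pair x -` A i)" "disjoint_family (\<lambda>i. (\<lambda>x. (x, y)) -` A i)"
        using union(1) unfolding disjoint_family_on_def by auto
      then show "emeasure \<nu> (Pair x -` (\<Union>i. A i)) = (\<Sum>i. emeasure \<nu> (Pair x -` A i))"
        "emeasure \<mu> ((\<lambda>x. (x, y)) -` (\<Union>i. A i)) = (\<Sum>i. emeasure \<mu> ((\<lambda>x. (x, y)) -` A i))"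
        using sec by (auto simp: vimage_UN intro!: suminf_emeasure[symmetric])
    qed
    show ?case
      unfolding eq using union(3) by (auto simp: nn_integral_suminf mm intro!: borel_measurable_suminf_order)
  qed
qed

theorem tonelli_finite_inner_regular:
  fixes \<mu> :: "'a::t2_space measure" and \<nu> :: "'b::t2_space measure" and F :: "'a \<times> 'b \<Rightarrow> ennreal"
  assumes \<mu>: "finite_inner_regular \<mu>" and \<nu>: "finite_inner_regular \<nu>"
    and F: "F \<in> borel_measurable borel"
  shows "(\<lambda>x. \<integral>\<^sup>+y. F (x, y) \<partial>\<nu>) \<in> borel_measurable borel \<and>
         (\<lambda>y. \<integral>\<^sup>+x. F (x, y) \<partial>\<mu>) \<in> borel_measurable borel \<and>
         (\<integral>\<^sup>+x. \<integral>\<^sup>+y. F (x, y) \<partial>\<nu> \<partial>\<mu>) = (\<integral>\<^sup>+y. \<integral>\<^sup>+x. F (x, y) \<partial>\<mu> \<partial>\<nu>)"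
proof -
  have s[measurable_cong, simp]: "sets \<mu> = sets borel" "sets \<nu> = sets borel"
    using \<mu> \<nu> by (auto simp: finite_inner_regular_def)
  have sp[simp]: "space \<mu> = UNIV" "space \<nu> = UNIV"
    using s(1,2)[THEN space_eq_UNIV_of_sets_borel] by auto
  have mm: "borel_measurable \<mu> = borel_measurable (borel :: 'a measure)"
           "borel_measurable \<nu> = borel_measurable (borel :: 'b measure)"
    by (auto intro: measurable_cong_sets)
  have sec: "(\<lambda>y. f (x, y)) \<in> borel_measurable borel" "(\<lambda>x. f (x, y)) \<in> borel_measurable borel"
    if "f \<in> borel_measurable borel" for f :: "'a \<times> 'b \<Rightarrow> ennreal" and x y
  proof -
    have "Pair x \<in> borel_measurable (borel :: 'b measure)" "(\<lambda>x. (x, y)) \<in> borel_measurable (borel :: 'a measure)"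
      by (intro borel_measurable_continuous_onI continuous_intros)+
    from this[THEN measurable_compose, OF that]
    show "(\<lambda>y. f (x, y)) \<in> borel_measurable borel" "(\<lambda>x. f (x, y)) \<in> borel_measurable borel" .
  qed
  show ?thesis using F
  proof (induction F rule: borel_measurable_induct)
    case (cong f g)
    then show ?case by simp
  next
    case (set E)
    have ind: "indicator E (x, y) = (indicator (Pair x -` E) y :: ennreal)" "indicator E (x, y) = (indicator ((\<lambda>x. (x, y)) -` E) x :: ennreal)"
      for x y by (auto simp: indicator_def)
    have "(\<integral>\<^sup>+y. indicator E (x, y) \<partial>\<nu>) = emeasure \<nu> (Pair x -` E)"
       "(\<integral>\<^sup>+x. indicator E (x, y) \<partial>\<mu>) = emeasure \<mu> ((\<lambda>x. (x, y)) -` E)" for x y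
      unfolding ind(1)[of x] ind(2)[of _ y] using measurable_Pair_section[OF set] by auto
    then show ?case using tonelli_borel_set[OF \<mu> \<nu> set] by simp
  next
    case (mult u c)
    then show ?case by (auto simp: nn_integral_cmult mm sec intro!: borel_measurable_times)
  next
    case (add u v)
    then show ?case by (auto simp: nn_integral_add mm sec intro!: borel_measurable_add)
  next
    case (seq U)
    have inc: "incseq (\<lambda>i y. U i (x, y))" "incseq (\<lambda>i x. U i (x, y))" for x y
      using \<open>incseq U\<close> by (auto simp: incseq_def le_fun_def)
    have eq: "(\<integral>\<^sup>+y. (SUP i. U i) (x, y) \<partial>\<nu>) = (SUP i. \<integral>\<^sup>+y. U i (x, y) \<partial>\<nu>)"
       "(\<integral>\<^sup>+x. (SUP i. U i) (x, y) \<partial>\<mu>) = (SUP i. \<integral>\<^sup>+x. U i (x, y) \<partial>\<mu>)" for x y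
      using nn_integral_monotone_convergence_SUP[OF inc(1)[of x], of \<nu>]
        nn_integral_monotone_convergence_SUP[OF inc(2)[of y], of \<mu>] sec[OF seq(1)]
      by (auto simp: mm SUP_apply image_image)
    have inc2: "incseq (\<lambda>i x. \<integral>\<^sup>+y. U i (x, y) \<partial>\<nu>)" "incseq (\<lambda>i y. \<integral>\<^sup>+x. U i (x, y) \<partial>\<mu>)"
      using \<open>incseq U\<close> by (auto simp: incseq_def le_fun_def intro!: nn_integral_mono)
    show ?case
      unfolding eq
      using nn_integral_monotone_convergence_SUP[OF inc2(1), of \<mu>]
        nn_integral_monotone_convergence_SUP[OF inc2(2), of \<nu>] seq.IH
      by (auto simp: mm intro!: borel_measurable_SUP)
  qed
qed

section \<open>Haar measure\<close>

locale haar_group =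
  fixes m :: "'g::{topological_group_add, t2_space} measure"
  assumes haar: "left_haar_measure m"
    and locally_compact: "locally_compact_space (euclidean :: 'g topology)"
begin

lemma sets_m [measurable_cong, simp]: "sets m = sets borel"
  using haar by (simp add: left_haar_measure_def)

lemma space_m [simp]: "space m = UNIV"
  by (rule space_eq_UNIV_of_sets_borel[OF sets_m])

lemma borel_measurable_m [simp]: "borel_measurable m = borel_measurable borel"
  by (auto intro: measurable_cong_sets)

lemma compact_borel [intro]: "compact (K :: 'g set) \<Longrightarrow> K \<in> sets borel"
  by (intro borel_closed compact_imp_closed)

lemma measurable_translate [measurable]:
  "(\<lambda>x. a + x) \<in> borel_measurable (borel :: 'g measure)"
  "(\<lambda>x. - x + a) \<in> borel_measurable (borel :: 'g measure)"
  for a :: 'g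
  by (intro borel_measurable_continuous_onI continuous_intros)+

lemma measurable_shear [measurable]:
  "(\<lambda>p. - snd p + fst p) \<in> borel_measurable (borel :: ('g \<times> 'g) measure)"
  "(\<lambda>p. fst p + snd p) \<in> borel_measurable (borel :: ('g \<times> 'g) measure)"
  "(fst :: 'g \<times> 'g \<Rightarrow> 'g) \<in> borel_measurable borel"
  "(snd :: 'g \<times> 'g \<Rightarrow> 'g) \<in> borel_measurable borel"
  by (intro borel_measurable_continuous_onI continuous_intros)+

lemma emeasure_translate:
  assumes "E \<in> sets borel"
  shows "emeasure m ((\<lambda>x. a + x) -` E) = emeasure m E"
proof -
  have "(\<lambda>x. a + x) -` E = (+) (- a) ` E"
  proof safe
    fix x assume "a + x \<in> E"
    moreover have "x = - a + (a + x)" by (simp add: add.assoc[symmetric])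
    ultimately show "x \<in> (+) (- a) ` E" by blast
  qed (simp add: add.assoc[symmetric])
  then show ?thesis using haar assms by (simp add: left_haar_measure_def)
qed

lemma nn_integral_translate:
  assumes "f \<in> borel_measurable borel"
  shows "(\<integral>\<^sup>+s. f (a + s) \<partial>m) = (\<integral>\<^sup>+s. f s \<partial>m)"
proof -
  have "distr m borel (\<lambda>x. a + x) = m"
  proof (rule measure_eqI)
    fix E assume "E \<in> sets (distr m borel (\<lambda>x. a + x))"
    then have E: "E \<in> sets borel" by simp
    then show "emeasure (distr m borel (\<lambda>x. a + x)) E = emeasure m E"
      by (subst emeasure_distr) (auto simp: emeasure_translate)
  qed simp
  then have "(\<integral>\<^sup>+s. f s \<partial>m) = (\<integral>\<^sup>+s. f s \<partial>distr m borel (\<lambda>x. a + x))" by simp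
  also have "\<dots> = (\<integral>\<^sup>+s. f (a + s) \<partial>m)"
    using assms by (intro nn_integral_distr) auto
  finally show ?thesis by simp
qed

lemma outer_regular:
  assumes "E \<in> sets borel" "emeasure m E < \<infinity>" "e > (0::real)"
  shows "\<exists>U. open U \<and> E \<subseteq> U \<and> emeasure m U \<le> emeasure m E + ennreal e"
proof -
  have eq: "emeasure m E = (INF U\<in>{U. open U \<and> E \<subseteq> U}. emeasure m U)"
    using haar assms(1) unfolding left_haar_measure_def by blast
  have "\<exists>U\<in>{U. open U \<and> E \<subseteq> U}. emeasure m U < emeasure m E + ennreal e"
    by (rule INF_approx_ennreal[OF _ eq]) (use assms(2,3) in auto)
  then show ?thesis by (auto intro: less_imp_le)
qed

lemma inner_regular_open:
  assumes "open U" "emeasure m U < \<infinity>" "e > (0::real)"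
  shows "\<exists>K. compact K \<and> K \<subseteq> U \<and> emeasure m U \<le> emeasure m K + ennreal e"
proof -
  have eq: "emeasure m U = (SUP K\<in>{K. compact K \<and> K \<subseteq> U}. emeasure m K)"
    using haar assms(1) unfolding left_haar_measure_def by blast
  have "\<exists>K\<in>{K. compact K \<and> K \<subseteq> U}. emeasure m U < emeasure m K + ennreal e"
    by (rule SUP_approx_ennreal[OF _ _ eq]) (use assms(2,3) in auto)
  then show ?thesis by (auto intro: less_imp_le)
qed

text \<open>Inside an open \<open>U \<supseteq> B\<close> of finite measure, take a large compact \<open>C \<subseteq> U\<close> and remove from it a
  tight open neighbourhood \<open>V\<close> of \<open>U - B\<close>.\<close>
lemma inner_regular:
  assumes B: "B \<in> sets borel" "emeasure m B < \<infinity>" and e: "e > (0::real)"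
  shows "\<exists>K. compact K \<and> K \<subseteq> B \<and> emeasure m B \<le> emeasure m K + ennreal e"
proof -
  obtain U where U: "open U" "B \<subseteq> U" "emeasure m U \<le> emeasure m B + ennreal 1"
    using outer_regular[OF B, of 1] by auto
  have Ufin: "emeasure m U < \<infinity>"
    using U(3) B(2) by (auto simp: less_top[symmetric] top_unique)
  obtain C where C: "compact C" "C \<subseteq> U" "emeasure m U \<le> emeasure m C + ennreal (e / 2)"
    using inner_regular_open[OF U(1) Ufin, of "e / 2"] e by auto
  have UB: "U - B \<in> sets borel" "emeasure m (U - B) < \<infinity>"
    using U(1) B(1) Ufin emeasure_mono[of "U - B" U m] by (auto intro: le_less_trans)
  obtain V where V: "open V" "U - B \<subseteq> V" "emeasure m V \<le> emeasure m (U - B) + ennreal (e / 2)"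
    using outer_regular[OF UB, of "e / 2"] e by auto
  have [measurable]: "U \<in> sets borel" "V \<in> sets borel" "C \<in> sets borel" "B \<in> sets borel"
    using U V C B by auto
  define K where "K = C - V"
  have K: "compact K" "K \<subseteq> B"
    using C V by (auto simp: K_def intro!: compact_diff)
  have [measurable]: "K \<in> sets borel" by (simp add: K_def)
  have Cfin: "emeasure m C \<noteq> \<infinity>"
    using Ufin emeasure_mono[OF C(2), of m] by auto
  have d1: "emeasure m (U - C) \<le> ennreal (e / 2)"
    using C(2,3) Cfin by (subst emeasure_Diff) (auto simp: ennreal_minus_le_iff)
  have d2: "emeasure m (V - (U - B)) \<le> ennreal (e / 2)"
    using V(2,3) UB by (subst emeasure_Diff) (auto simp: ennreal_minus_le_iff)
  have "emeasure m B \<le> emeasure m (K \<union> ((U - C) \<union> (V - (U - B))))"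
    using U(2) by (intro emeasure_mono) (auto simp: K_def)
  also have "\<dots> \<le> emeasure m K + (emeasure m (U - C) + emeasure m (V - (U - B)))"
    by (intro order_trans[OF emeasure_subadditive] add_left_mono) auto
  also have "\<dots> \<le> emeasure m K + (ennreal (e / 2) + ennreal (e / 2))"
    using d1 d2 by (intro add_mono) auto
  also have "ennreal (e / 2) + ennreal (e / 2) = ennreal e"
    using e by (subst ennreal_plus[symmetric]) auto
  finally show ?thesis using K by blast
qed

text \<open>Haar measure itself need not be \<open>\<sigma>\<close>-finite, and a Borel set of infinite measure need not be
  approximable from inside. Weighting by an integrable \<open>g\<close> removes both defects: up to small
  \<open>g\<close>-mass, \<open>A\<close> lies where \<open>g\<close> is bounded and bounded away from \<open>0\<close>, and that part of \<open>A\<close> has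
  finite measure.\<close>
lemma density_inner_regular:
  assumes g: "integrable m g" "\<And>x. g x \<ge> (0::real)" and A: "A \<in> sets borel" and e: "e > (0::real)"
  shows "\<exists>K. compact K \<and> K \<subseteq> A \<and> emeasure (density m g) A \<le> emeasure (density m g) K + ennreal e"
proof -
  define \<nu> where "\<nu> = density m (\<lambda>x. ennreal (g x))"
  have [measurable]: "g \<in> borel_measurable borel" "A \<in> sets borel" using g(1) A by (auto dest: borel_measurable_integrable)
  have s[simp, measurable_cong]: "sets \<nu> = sets borel" by (simp add: \<nu>_def)
  have gfin: "(\<integral>\<^sup>+x. g x \<partial>m) < \<infinity>"
    using g by (simp add: integrable_iff_bounded)
  have \<nu>fin: "emeasure \<nu> E < \<infinity>" for E
  proof -
    have "emeasure \<nu> E \<le> emeasure \<nu> (space \<nu>)" by (rule emeasure_space)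
    also have "\<dots> = (\<integral>\<^sup>+x. g x \<partial>m)" unfolding \<nu>_def by (subst emeasure_density) auto
    finally show ?thesis using gfin by (rule le_less_trans)
  qed
  define B where "B n = A \<inter> {x. 1 / (real n + 1) < g x \<and> g x \<le> real n + 1}" for n
  have [measurable]: "B n \<in> sets borel" for n unfolding B_def by measurable
  have incB: "incseq B"
  proof (rule incseq_SucI, rule subsetI)
    fix n x assume x: "x \<in> B n"
    have "1 / (real (Suc n) + 1) \<le> 1 / (real n + 1)" by (intro divide_left_mono) auto
    with x show "x \<in> B (Suc n)" by (auto simp: B_def)
  qed
  have UB: "(\<Union>n. B n) = A \<inter> {x. g x \<noteq> 0}"
  proof safe
    fix x assume x: "x \<in> A" "g x \<noteq> 0"
    then have gx: "g x > 0" using g(2)[of x] by linarith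
    obtain n1 :: nat where n1: "1 / g x < n1" using reals_Archimedean2 by blast
    obtain n2 :: nat where n2: "g x < n2" using reals_Archimedean2 by blast
    have "1 / (real (n1 + n2) + 1) < g x"
    proof -
      have "1 < g x * real n1" using n1 gx by (simp add: field_simps)
      also have "\<dots> \<le> g x * (real (n1 + n2) + 1)" using gx by (intro mult_left_mono) auto
      finally show ?thesis by (simp add: field_simps)
    qed
    then show "x \<in> (\<Union>n. B n)" using n2 x(1) by (intro UN_I[of "n1 + n2"]) (auto simp: B_def)
  next
    fix x n assume "x \<in> B n"
    then have x: "x \<in> A" "1 / (real n + 1) < g x" by (auto simp: B_def)
    have "0 < 1 / (real n + 1)" by simp
    with x show "x \<in> A" "g x = 0 \<Longrightarrow> False" by auto
  qed
  have "emeasure \<nu> A = emeasure \<nu> (\<Union>n. B n)"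
    unfolding UB \<nu>_def
    by (subst (1 2) emeasure_density) (auto intro!: nn_integral_cong simp: indicator_def)
  also have "\<dots> = (SUP n. emeasure \<nu> (B n))"
    by (rule SUP_emeasure_incseq[symmetric]) (auto simp: incB)
  finally have eq: "emeasure \<nu> A = (SUP n. emeasure \<nu> (B n))" .
  have "\<exists>n\<in>UNIV. emeasure \<nu> A < emeasure \<nu> (B n) + ennreal (e / 2)"
    by (rule SUP_approx_ennreal[OF _ _ eq]) (use e \<nu>fin[of A] in auto)
  then obtain n where n: "emeasure \<nu> A < emeasure \<nu> (B n) + ennreal (e / 2)" by blast
  have "ennreal (1 / (real n + 1)) * emeasure m (B n) = (\<integral>\<^sup>+x. ennreal (1 / (real n + 1)) * indicator (B n) x \<partial>m)"
    by (subst nn_integral_cmult_indicator) auto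
  also have "\<dots> \<le> (\<integral>\<^sup>+x. g x \<partial>m)"
    by (intro nn_integral_mono) (auto simp: B_def indicator_def intro!: ennreal_leI)
  finally have "ennreal (1 / (real n + 1)) * emeasure m (B n) < \<infinity>" using gfin by (rule le_less_trans)
  then have Bfin: "emeasure m (B n) < \<infinity>"
    by (auto simp: ennreal_mult_less_top)
  obtain K where K: "compact K" "K \<subseteq> B n" "emeasure m (B n) \<le> emeasure m K + ennreal (e / 2 / (real n + 1))"
    using inner_regular[OF _ Bfin, of "e / 2 / (real n + 1)"] e by auto
  have [measurable]: "K \<in> sets borel" using K(1) by auto
  have d: "emeasure m (B n - K) \<le> ennreal (e / 2 / (real n + 1))"
    using K(2,3) Bfin emeasure_mono[OF K(2), of m]
    by (subst emeasure_Diff) (auto simp: ennreal_minus_le_iff top_unique)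
  have "emeasure \<nu> (B n - K) \<le> (\<integral>\<^sup>+x. ennreal (real n + 1) * indicator (B n - K) x \<partial>m)"
    unfolding \<nu>_def
    by (subst emeasure_density) (auto intro!: nn_integral_mono ennreal_leI simp: indicator_def B_def simp del: ennreal_plus)
  also have "\<dots> = ennreal (real n + 1) * emeasure m (B n - K)"
    by (subst nn_integral_cmult_indicator) auto
  also have "\<dots> \<le> ennreal (real n + 1) * ennreal (e / 2 / (real n + 1))"
    using d by (rule mult_left_mono) auto
  also have "\<dots> = ennreal (e / 2)"
    using e by (subst ennreal_mult'[symmetric]) (auto simp: field_simps simp del: ennreal_plus intro!: arg_cong[of _ _ ennreal])
  finally have d': "emeasure \<nu> (B n - K) \<le> ennreal (e / 2)" .
  have "emeasure \<nu> (B n) \<le> emeasure \<nu> K + emeasure \<nu> (B n - K)"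
    using K(2) by (intro order_trans[OF _ emeasure_subadditive] emeasure_mono) auto
  with d' have "emeasure \<nu> (B n) \<le> emeasure \<nu> K + ennreal (e / 2)"
    by (meson add_left_mono order_trans)
  then have "emeasure \<nu> A \<le> emeasure \<nu> K + ennreal (e / 2) + ennreal (e / 2)"
    using n by (meson add_right_mono less_imp_le order_trans)
  also have "\<dots> = emeasure \<nu> K + ennreal e"
    using e by (simp add: add.assoc ennreal_plus[symmetric] del: ennreal_plus)
  finally show ?thesis using K(1,2) unfolding \<nu>_def B_def by blast
qed

lemma finite_inner_regular_density:
  assumes g: "integrable m g" "\<And>x. g x \<ge> (0::real)"
  shows "finite_inner_regular (density m g)"
proof -
  have [measurable]: "g \<in> borel_measurable borel" using g(1) by (auto dest: borel_measurable_integrable)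
  have "emeasure (density m g) UNIV = (\<integral>\<^sup>+x. g x \<partial>m)" by (subst emeasure_density) auto
  also have "\<dots> < \<infinity>" using g by (simp add: integrable_iff_bounded)
  finally show ?thesis
    unfolding finite_inner_regular_def using density_inner_regular[OF g] by (auto simp: borel_open)
qed

text \<open>This is the substitute for \<open>\<sigma>\<close>-finiteness of the group.\<close>
lemma integrable_sigma_compact_support:
  assumes g: "integrable m g" "\<And>x. g x \<ge> (0::real)"
  shows "\<exists>K :: nat \<Rightarrow> 'g set. (\<forall>n. compact (K n)) \<and> (AE x in m. x \<notin> (\<Union>n. K n) \<longrightarrow> g x = 0)"
proof -
  define \<nu> where "\<nu> = density m (\<lambda>x. ennreal (g x))"
  have [measurable]: "g \<in> borel_measurable borel" using g(1) by (auto dest: borel_measurable_integrable)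
  have [simp]: "sets \<nu> = sets borel" by (simp add: \<nu>_def)
  have fin: "emeasure \<nu> E \<noteq> \<infinity>" for E
  proof -
    have "emeasure \<nu> E \<le> emeasure \<nu> UNIV" using emeasure_space[of \<nu> E] by (simp add: \<nu>_def)
    also have "\<dots> < \<infinity>" using finite_inner_regular_density[OF g] by (simp add: \<nu>_def finite_inner_regular_def)
    finally show ?thesis by simp
  qed
  have "\<exists>K. compact K \<and> emeasure \<nu> UNIV \<le> emeasure \<nu> K + ennreal (1 / (real n + 1))" for n
    using density_inner_regular[OF g, of UNIV "1 / (real n + 1)"] by (auto simp: \<nu>_def)
  then obtain K where K: "\<And>n. compact (K n)"
    "\<And>n. emeasure \<nu> UNIV \<le> emeasure \<nu> (K n) + ennreal (1 / (real n + 1))" by metis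
  have [measurable]: "K n \<in> sets borel" for n using K(1) by auto
  let ?N = "UNIV - (\<Union>n. K n)"
  have "emeasure \<nu> ?N \<le> 0"
  proof (rule ennreal_le_epsilon)
    fix e :: real assume "e > 0"
    then obtain n where n: "1 / (real n + 1) < e"
      using nat_approx_posE[of e] by (auto simp: add.commute)
    have "emeasure \<nu> ?N \<le> emeasure \<nu> (UNIV - K n)" by (intro emeasure_mono) auto
    also have "\<dots> \<le> ennreal (1 / (real n + 1))"
      using K(2)[of n] fin by (subst emeasure_Diff) (auto simp: ennreal_minus_le_iff)
    also have "\<dots> \<le> ennreal e" using n by (intro ennreal_leI) auto
    finally show "emeasure \<nu> ?N \<le> 0 + ennreal e" by simp
  qed
  then have "emeasure \<nu> ?N = 0" by simp
  then have "(\<integral>\<^sup>+x. ennreal (g x) * indicator ?N x \<partial>m) = 0"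
    unfolding \<nu>_def by (subst (asm) emeasure_density) auto
  then have "AE x in m. ennreal (g x) * indicator ?N x = 0"
    by (subst (asm) nn_integral_0_iff_AE) auto
  then have "AE x in m. x \<notin> (\<Union>n. K n) \<longrightarrow> g x = 0"
    by eventually_elim (use g(2) in \<open>auto simp: indicator_def ennreal_eq_0_iff intro: antisym split: if_splits\<close>)
  then show ?thesis using K(1) by blast
qed

lemma compact_neighbourhood: "\<exists>U K. open U \<and> (0::'g) \<in> U \<and> compact K \<and> U \<subseteq> K"
proof -
  have "\<exists>U K. openin euclidean U \<and> compactin euclidean K \<and> (0::'g) \<in> U \<and> U \<subseteq> K"
    using locally_compact unfolding locally_compact_space_def by simp
  then show ?thesis by (simp only: open_openin compactin_euclidean_iff) blast
qed

lemma emeasure_compact: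
  assumes "compact K"
  shows "emeasure m K < \<infinity>"
proof -
  have "\<forall>K. compact K \<longrightarrow> emeasure m K < \<infinity>"
    using haar unfolding left_haar_measure_def by (elim conjE)
  then show ?thesis using assms by simp
qed

lemma open_translate: "open U \<Longrightarrow> open ((\<lambda>x. (a::'g) + x) -` U)"
  by (erule open_vimage) (intro continuous_intros)

text \<open>Translates of a null open set would cover every compact set, finitely many at a time, so all
  compact sets would be null and hence, by inner regularity, the whole group.\<close>
lemma emeasure_open_pos:
  assumes U: "open U" "U \<noteq> {}"
  shows "emeasure m U > 0"
proof (rule ccontr)
  assume "\<not> emeasure m U > 0"
  then have U0: "emeasure m U = 0" by simp
  obtain u where u: "u \<in> U" using U by blast
  have null: "emeasure m K = 0" if K: "compact K" for K
  proof -
    have "K \<subseteq> (\<Union>a\<in>UNIV. (\<lambda>x. a + x) -` U)"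
    proof
      fix x assume "x \<in> K"
      have "(u - x) + x \<in> U" using u by simp
      then show "x \<in> (\<Union>a\<in>UNIV. (\<lambda>x. a + x) -` U)" by blast
    qed
    then obtain C where C: "finite C" "K \<subseteq> (\<Union>a\<in>C. (\<lambda>x. a + x) -` U)"
      using compactE_image[OF K, of UNIV "\<lambda>a. (\<lambda>x. a + x) -` U"] open_translate[OF U(1)] by metis
    have "emeasure m K \<le> emeasure m (\<Union>a\<in>C. (\<lambda>x. a + x) -` U)"
      using C open_translate[OF U(1)] by (intro emeasure_mono) auto
    also have "\<dots> \<le> (\<Sum>a\<in>C. emeasure m ((\<lambda>x. a + x) -` U))"
      using C(1) open_translate[OF U(1)] by (intro emeasure_subadditive_finite) auto
    also have "\<dots> = 0" using U(1) U0 by (simp add: emeasure_translate)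
    finally show ?thesis by simp
  qed
  have "emeasure m UNIV = (SUP K\<in>{K. compact K \<and> K \<subseteq> UNIV}. emeasure m K)"
    using haar unfolding left_haar_measure_def by blast
  also have "\<dots> \<le> 0" by (rule SUP_least) (simp add: null)
  finally show False using haar by (simp add: left_haar_measure_def)
qed

text \<open>Inversion preserves null sets in the sense needed for convolution. Suppose that \<open>K\<close> is compact
  and \<open>- t + s \<in> N\<close> for all \<open>t \<in> K\<close>. For a compact neighbourhood \<open>K0\<close> of \<open>0\<close>, left invariance
  gives that the double integral of the indicator of \<open>s - u + t \<in> K\<close> over \<open>u \<in> K0\<close> and \<open>t\<close> is
  \<open>m K0 * m K\<close>. In the other order it is \<open>0\<close>, because for fixed \<open>t\<close> the admissible \<open>u\<close> lie in
  the left translate \<open>t + N\<close>. So \<open>K\<close> is null; inner regularity of the measure with density \<open>g\<close>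
  passes from such \<open>K\<close> to the whole set of bad \<open>t\<close>.\<close>
lemma null_set_reflected:
  assumes N: "N \<in> sets borel" "emeasure m N = 0" and g: "integrable m g" "\<And>x. g x \<ge> (0::real)"
  shows "AE t in m. g t \<noteq> 0 \<longrightarrow> - t + s \<notin> N"
proof -
  have [measurable]: "g \<in> borel_measurable borel" using g(1) by (auto dest: borel_measurable_integrable)
  define A where "A = (\<lambda>t. - t + s) -` N"
  have A[measurable]: "A \<in> sets borel"
    using measurable_sets[OF measurable_translate(2) N(1)] by (simp add: A_def)
  obtain U K0 :: "'g set" where UK: "open U" "0 \<in> U" "compact K0" "U \<subseteq> K0"
    using compact_neighbourhood by blast
  have null: "emeasure m K = 0" if K: "compact K" "K \<subseteq> A" for K
  proof -
    \<comment> \<open>\<open>K'\<close> contains every translate \<open>u - s + K\<close> with \<open>u \<in> K0\<close>, so cutting down to \<open>K'\<close> makes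
      the second measure finite and loses nothing.\<close>
    define K' where "K' = (\<lambda>p. fst p - s + snd p) ` (K0 \<times> K)"
    have K': "compact K'"
      unfolding K'_def by (intro compact_continuous_image compact_Times UK K continuous_intros)
    have [measurable]: "K \<in> sets borel" "K' \<in> sets borel" "K0 \<in> sets borel" using K K' UK by auto
    define E where "E = {p. s - fst p + snd p \<in> K}"
    have "closed ((\<lambda>p :: 'g \<times> 'g. s - fst p + snd p) -` K)"
      by (intro closed_vimage compact_imp_closed K continuous_intros)
    then have E: "E \<in> sets borel" by (simp add: E_def vimage_def)
    have int: "integrable m (indicator C :: 'g \<Rightarrow> real)" if "compact C" for C
      using that emeasure_compact[OF that] by (intro integrable_real_indicator) auto
    have fir: "finite_inner_regular (density m (indicator C :: 'g \<Rightarrow> real))" if "compact C" for C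
      by (rule finite_inner_regular_density[OF int[OF that]]) auto
    have dens: "emeasure (density m (indicator C :: 'g \<Rightarrow> real)) X = emeasure m (C \<inter> X)"
      if "compact C" "X \<in> sets borel" for C X
    proof -
      have [measurable]: "C \<in> sets borel" "X \<in> sets borel" using that by auto
      have "emeasure (density m (indicator C :: 'g \<Rightarrow> real)) X
          = (\<integral>\<^sup>+x. ennreal (indicator C x) * indicator X x \<partial>m)"
        by (subst emeasure_density) auto
      also have "\<dots> = (\<integral>\<^sup>+x. indicator (C \<inter> X) x \<partial>m)"
        by (intro nn_integral_cong) (auto simp: indicator_def)
      finally show ?thesis by simp
    qed
    note sec = measurable_Pair_section[OF E]
    have "emeasure m K0 * emeasure m K = (\<integral>\<^sup>+u. emeasure m K * indicator K0 u \<partial>m)"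
      by (subst nn_integral_cmult_indicator) (auto simp: mult.commute)
    also have "\<dots> = (\<integral>\<^sup>+u. indicator K0 u * emeasure m (K' \<inter> Pair u -` E) \<partial>m)"
    proof (intro nn_integral_cong)
      fix u
      have "emeasure m (K' \<inter> Pair u -` E) = emeasure m K" if "u \<in> K0"
      proof -
        have "K' \<inter> Pair u -` E = (\<lambda>x. (s - u) + x) -` K"
        proof (intro equalityI subsetI)
          fix t assume t: "t \<in> (\<lambda>x. (s - u) + x) -` K"
          have "t = u - s + ((s - u) + t)" by (simp add: add.assoc[symmetric] add_diff_eq)
          with t that have "t \<in> K'" unfolding K'_def
            by (intro image_eqI[of _ _ "(u, (s - u) + t)"]) auto
          with t show "t \<in> K' \<inter> Pair u -` E" by (simp add: E_def)
        qed (auto simp: E_def)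
        then show ?thesis by (simp add: emeasure_translate)
      qed
      then show "emeasure m K * indicator K0 u = indicator K0 u * emeasure m (K' \<inter> Pair u -` E)"
        by (auto simp: indicator_def)
    qed
    also have "\<dots> = (\<integral>\<^sup>+u. emeasure (density m (indicator K' :: 'g \<Rightarrow> real)) (Pair u -` E)
         \<partial>density m (indicator K0 :: 'g \<Rightarrow> real))"
    proof -
      have "(\<lambda>u. emeasure m (K' \<inter> Pair u -` E)) \<in> borel_measurable borel"
        using tonelli_borel_set[OF fir[OF UK(3)] fir[OF K'] E] unfolding dens[OF K' sec(1)] by blast
      then show ?thesis unfolding dens[OF K' sec(1)]
        by (subst nn_integral_density) (auto simp: ennreal_indicator)
    qed
    also have "\<dots> = (\<integral>\<^sup>+t. emeasure (density m (indicator K0 :: 'g \<Rightarrow> real)) ((\<lambda>u. (u, t)) -` E)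
         \<partial>density m (indicator K' :: 'g \<Rightarrow> real))"
      using tonelli_borel_set[OF fir[OF UK(3)] fir[OF K'] E] by blast
    also have "\<dots> = (\<integral>\<^sup>+t. 0 \<partial>density m (indicator K' :: 'g \<Rightarrow> real))"
    proof (intro nn_integral_cong)
      fix t
      have "K0 \<inter> (\<lambda>u. (u, t)) -` E \<subseteq> (\<lambda>u. - t + u) -` N"
      proof
        fix u assume "u \<in> K0 \<inter> (\<lambda>u. (u, t)) -` E"
        then have "- (s - u + t) + s \<in> N" using K(2) by (auto simp: E_def A_def)
        also have "- (s - u + t) + s = - t + u"
          by (simp add: minus_add add.assoc)
        finally show "u \<in> (\<lambda>u. - t + u) -` N" by simp
      qed
      then have "emeasure m (K0 \<inter> (\<lambda>u. (u, t)) -` E) \<le> emeasure m ((\<lambda>u. - t + u) -` N)"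
        using measurable_sets[OF measurable_translate(1) N(1)] by (intro emeasure_mono) auto
      then show "emeasure (density m (indicator K0 :: 'g \<Rightarrow> real)) ((\<lambda>u. (u, t)) -` E) = 0"
        using N UK(3) sec(2) by (simp add: dens emeasure_translate)
    qed
    finally have "emeasure m K0 * emeasure m K = 0" by simp
    moreover have "emeasure m K0 > 0"
      using emeasure_open_pos[OF UK(1)] UK(2,4) emeasure_mono[OF UK(4), of m] UK(3)
      by (auto intro: less_le_trans)
    ultimately show ?thesis by auto
  qed
  have "emeasure (density m g) A \<le> 0"
  proof (rule ennreal_le_epsilon)
    fix e :: real assume "e > 0"
    then obtain K where K: "compact K" "K \<subseteq> A" "emeasure (density m g) A \<le> emeasure (density m g) K + ennreal e"
      using density_inner_regular[OF g A] by blast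
    have [measurable]: "K \<in> sets borel" using K(1) by auto
    have "AE x in m. x \<notin> K" using null[OF K(1,2)] by (intro AE_not_in) (auto simp: null_sets_def)
    then have "emeasure (density m g) K = 0"
      by (subst emeasure_density) (auto simp: nn_integral_0_iff_AE)
    with K(3) show "emeasure (density m g) A \<le> 0 + ennreal e" by simp
  qed
  then have "(\<integral>\<^sup>+x. ennreal (g x) * indicator A x \<partial>m) = 0"
    by (subst (asm) emeasure_density) auto
  then have "AE x in m. ennreal (g x) * indicator A x = 0"
    by (subst (asm) nn_integral_0_iff_AE) auto
  then show ?thesis
    by eventually_elim (use g(2) in \<open>auto simp: A_def indicator_def ennreal_eq_0_iff intro: antisym split: if_splits\<close>)
qed

section \<open>Convolution of integrable functions\<close>

lemma borel_measurable_integral_section: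
  assumes b: "integrable m b" "\<And>x. b x \<ge> (0::real)" and F: "F \<in> borel_measurable (borel :: ('g \<times> 'g) measure)"
  shows "(\<lambda>s. \<integral>\<^sup>+t. ennreal (b t) * F (s, t) \<partial>m) \<in> borel_measurable borel"
proof -
  have [measurable]: "b \<in> borel_measurable borel" using b(1) by (auto dest: borel_measurable_integrable)
  have P: "Pair s \<in> borel_measurable (borel :: 'g measure)" for s :: 'g
    by (intro borel_measurable_continuous_onI continuous_intros)
  have "(\<lambda>t. F (s, t)) \<in> borel_measurable borel" for s
    using measurable_compose[OF P F] .
  then have "(\<integral>\<^sup>+t. ennreal (b t) * F (s, t) \<partial>m) = (\<integral>\<^sup>+t. F (s, t) \<partial>density m b)" for s
    by (subst nn_integral_density) auto
  moreover have "finite_inner_regular (density m b)" by (rule finite_inner_regular_density[OF b])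
  ultimately show ?thesis using tonelli_finite_inner_regular[OF _ _ F] by auto
qed

text \<open>Tonelli's theorem and left invariance, after the outer integral has been reduced to a
  \<open>\<sigma>\<close>-compact set. The reduction works because \<open>b\<close> and \<open>f\<close> vanish almost everywhere outside
  \<open>\<sigma>\<close>-compact sets, and \<open>null_set_reflected\<close> makes the inner integral vanish at every \<open>s\<close> outside the sum of
  these two sets. With \<open>k = 1\<close> this is the submultiplicativity of the \<open>L\<^sup>1\<close>-norm, with \<open>k\<close> a weight
  that of the weighted norm, and with \<open>k\<close> the indicator of a set it bounds the mass of a
  convolution on that set.\<close>
lemma convolution_inequality:
  assumes b: "integrable m b" "\<And>x. b x \<ge> (0::real)" and f: "integrable m f" "\<And>x. f x \<ge> (0::real)"
    and k: "k \<in> borel_measurable borel"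
  shows "(\<integral>\<^sup>+s. k s * (\<integral>\<^sup>+t. ennreal (b t) * ennreal (f (- t + s)) \<partial>m) \<partial>m)
       \<le> (\<integral>\<^sup>+t. ennreal (b t) * (\<integral>\<^sup>+s. k (t + s) * ennreal (f s) \<partial>m) \<partial>m)"
proof -
  have [measurable]: "b \<in> borel_measurable borel" "f \<in> borel_measurable borel" "k \<in> borel_measurable borel"
    using b(1) f(1) k by (auto dest: borel_measurable_integrable)
  define h where "h s = (\<integral>\<^sup>+t. ennreal (b t) * ennreal (f (- t + s)) \<partial>m)" for s
  have h_meas[measurable]: "h \<in> borel_measurable borel"
    unfolding h_def using borel_measurable_integral_section[OF b, of "\<lambda>p. ennreal (f (- snd p + fst p))"] by simp
  obtain Kb :: "nat \<Rightarrow> 'g set" where Kb: "\<And>n. compact (Kb n)" "AE x in m. x \<notin> (\<Union>n. Kb n) \<longrightarrow> b x = 0"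
    using integrable_sigma_compact_support[OF b] by blast
  obtain Kf :: "nat \<Rightarrow> 'g set" where Kf: "\<And>n. compact (Kf n)" "AE x in m. x \<notin> (\<Union>n. Kf n) \<longrightarrow> f x = 0"
    using integrable_sigma_compact_support[OF f] by blast
  have [measurable]: "Kb n \<in> sets borel" "Kf n \<in> sets borel" for n using Kb(1) Kf(1) by auto
  define S where "S n = (\<Union>i\<in>{..n}. \<Union>j\<in>{..n}. (\<lambda>p. fst p + snd p) ` (Kb i \<times> Kf j))" for n
  have S: "compact (S n)" for n
    unfolding S_def
    by (intro compact_UN compact_continuous_image compact_Times Kb Kf continuous_intros) auto
  have [measurable]: "S n \<in> sets borel" for n using S by auto
  have Sinc: "incseq S" unfolding incseq_def S_def by (intro allI impI UN_mono) auto
  \<comment> \<open>the part of \<open>f\<close> that its \<open>\<sigma>\<close>-compact support misses\<close>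
  define N where "N = {x. x \<notin> (\<Union>n. Kf n) \<and> f x \<noteq> 0}"
  have N: "N \<in> sets borel" unfolding N_def by measurable
  have N0: "emeasure m N = 0"
    using Kf(2) N by (subst (asm) AE_iff_measurable[of N]) (auto simp: N_def)
  have h0: "h s = 0" if s: "s \<notin> (\<Union>n. S n)" for s
  proof -
    have "AE t in m. ennreal (b t) * ennreal (f (- t + s)) = 0"
      using Kb(2) null_set_reflected[OF N N0 b, of s]
    proof eventually_elim
      case (elim t)
      have "f (- t + s) = 0" if "b t \<noteq> 0"
      proof (rule ccontr)
        assume "f (- t + s) \<noteq> 0"
        with elim that obtain i j where "t \<in> Kb i" "- t + s \<in> Kf j" by (auto simp: N_def)
        then have "(t, - t + s) \<in> Kb i \<times> Kf j" by simp
        moreover have "s = t + (- t + s)" by (simp add: add.assoc[symmetric])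
        ultimately have "s \<in> (\<lambda>p. fst p + snd p) ` (Kb i \<times> Kf j)"
          by (intro image_eqI[of _ _ "(t, - t + s)"]) auto
        then have "s \<in> S (max i j)" unfolding S_def
          by (intro UN_I[of i] UN_I[of j]) auto
        with s show False by blast
      qed
      then have "b t = 0 \<or> f (- t + s) = 0" by blast
      then show ?case by (elim disjE) simp_all
    qed
    then have "h s = (\<integral>\<^sup>+t. 0 \<partial>m)" unfolding h_def by (rule nn_integral_cong_AE)
    then show ?thesis by simp
  qed
  define R where "R = (\<integral>\<^sup>+t. ennreal (b t) * (\<integral>\<^sup>+s. k (t + s) * ennreal (f s) \<partial>m) \<partial>m)"
  have bound: "(\<integral>\<^sup>+s. indicator (S n) s * (k s * h s) \<partial>m) \<le> R" for n
  proof -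
    let ?\<mu> = "density m (indicator (S n) :: 'g \<Rightarrow> real)" and ?\<nu> = "density m b"
    let ?F = "\<lambda>p. k (fst p) * ennreal (f (- snd p + fst p))"
    have \<mu>: "finite_inner_regular ?\<mu>"
      using S[of n] emeasure_compact[OF S[of n]]
      by (intro finite_inner_regular_density integrable_real_indicator) auto
    have \<nu>: "finite_inner_regular ?\<nu>" by (rule finite_inner_regular_density[OF b])
    have F: "?F \<in> borel_measurable borel" by measurable
    have inner: "(\<integral>\<^sup>+t. ?F (s, t) \<partial>?\<nu>) = k s * h s" for s
    proof -
      have "(\<integral>\<^sup>+t. ?F (s, t) \<partial>?\<nu>) = (\<integral>\<^sup>+t. k s * (ennreal (b t) * ennreal (f (- t + s))) \<partial>m)"
        by (subst nn_integral_density) (auto simp: mult_ac)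
      also have "\<dots> = k s * h s" unfolding h_def by (subst nn_integral_cmult) auto
      finally show ?thesis .
    qed
    have G: "(\<lambda>t. \<integral>\<^sup>+s. k (t + s) * ennreal (f s) \<partial>m) \<in> borel_measurable borel"
      using borel_measurable_integral_section[OF f, of "\<lambda>p. k (fst p + snd p)"] by (simp add: mult.commute)
    have "(\<integral>\<^sup>+s. indicator (S n) s * (k s * h s) \<partial>m) = (\<integral>\<^sup>+s. \<integral>\<^sup>+t. ?F (s, t) \<partial>?\<nu> \<partial>?\<mu>)"
      unfolding inner by (subst nn_integral_density) (auto simp: ennreal_indicator)
    also have "\<dots> = (\<integral>\<^sup>+t. \<integral>\<^sup>+s. ?F (s, t) \<partial>?\<mu> \<partial>?\<nu>)"
      using tonelli_finite_inner_regular[OF \<mu> \<nu> F] by blast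
    also have "\<dots> \<le> (\<integral>\<^sup>+t. \<integral>\<^sup>+s. k (t + s) * ennreal (f s) \<partial>m \<partial>?\<nu>)"
    proof (rule nn_integral_mono)
      fix t
      have "(\<integral>\<^sup>+s. ?F (s, t) \<partial>?\<mu>) = (\<integral>\<^sup>+s. indicator (S n) s * ?F (s, t) \<partial>m)"
        by (subst nn_integral_density) (auto simp: ennreal_indicator)
      also have "\<dots> \<le> (\<integral>\<^sup>+s. ?F (s, t) \<partial>m)"
        by (intro nn_integral_mono) (auto simp: indicator_def)
      also have "\<dots> = (\<integral>\<^sup>+s. ?F (t + s, t) \<partial>m)"
        by (subst nn_integral_translate[where a = t, symmetric]) auto
      also have "\<dots> = (\<integral>\<^sup>+s. k (t + s) * ennreal (f s) \<partial>m)"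
        by (simp add: add.assoc[symmetric])
      finally show "(\<integral>\<^sup>+s. ?F (s, t) \<partial>?\<mu>) \<le> \<dots>" .
    qed
    also have "\<dots> = R"
      unfolding R_def using G by (subst nn_integral_density) auto
    finally show ?thesis .
  qed
  have "(\<integral>\<^sup>+s. k s * h s \<partial>m) = (\<integral>\<^sup>+s. (SUP n. indicator (S n) s * (k s * h s)) \<partial>m)"
  proof (intro nn_integral_cong antisym)
    fix s
    show "k s * h s \<le> (SUP n. indicator (S n) s * (k s * h s))"
    proof (cases "s \<in> (\<Union>n. S n)")
      case True
      then obtain n where "s \<in> S n" by blast
      then show ?thesis by (intro SUP_upper2[of n]) auto
    qed (simp add: h0)
  qed (auto intro!: SUP_least simp: indicator_def)
  also have "\<dots> = (SUP n. \<integral>\<^sup>+s. indicator (S n) s * (k s * h s) \<partial>m)"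
    using Sinc by (intro nn_integral_monotone_convergence_SUP)
      (auto simp: incseq_def le_fun_def indicator_def)
  also have "\<dots> \<le> R" by (rule SUP_least) (rule bound)
  finally show ?thesis unfolding h_def R_def .
qed

lemma borel_measurable_lebesgue_section:
  fixes G :: "'g \<times> 'g \<Rightarrow> real"
  assumes b: "integrable m b" "\<And>x. b x \<ge> (0::real)" and G[measurable]: "G \<in> borel_measurable borel"
  shows "(\<lambda>s. LINT t|m. b t * G (s, t)) \<in> borel_measurable borel"
proof -
  have b_meas[measurable]: "b \<in> borel_measurable borel" using b(1) by (auto dest: borel_measurable_integrable)
  have P: "Pair s \<in> borel_measurable (borel :: 'g measure)" for s :: 'g
    by (intro borel_measurable_continuous_onI continuous_intros)
  have sec[measurable]: "(\<lambda>t. G (s, t)) \<in> borel_measurable borel" for s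
    using measurable_compose[OF P G] .
  define pos where "pos s = (\<integral>\<^sup>+t. ennreal (b t) * ennreal (G (s, t)) \<partial>m)" for s
  define neg where "neg s = (\<integral>\<^sup>+t. ennreal (b t) * ennreal (- G (s, t)) \<partial>m)" for s
  define tot where "tot s = (\<integral>\<^sup>+t. ennreal (b t) * ennreal \<bar>G (s, t)\<bar> \<partial>m)" for s
  have [measurable]: "pos \<in> borel_measurable borel" "neg \<in> borel_measurable borel" "tot \<in> borel_measurable borel"
    unfolding pos_def neg_def tot_def
    using borel_measurable_integral_section[OF b, of "\<lambda>p. ennreal (G p)"]
      borel_measurable_integral_section[OF b, of "\<lambda>p. ennreal (- G p)"]
      borel_measurable_integral_section[OF b, of "\<lambda>p. ennreal \<bar>G p\<bar>"] by auto
  have "(LINT t|m. b t * G (s, t)) = (if tot s < \<infinity> then enn2real (pos s) - enn2real (neg s) else 0)" for s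
  proof -
    have "(\<integral>\<^sup>+t. ennreal (norm (b t * G (s, t))) \<partial>m) = tot s"
      unfolding tot_def using b(2) by (intro nn_integral_cong) (simp add: abs_mult ennreal_mult)
    moreover have "(\<lambda>t. b t * G (s, t)) \<in> borel_measurable m" by simp
    ultimately have int: "integrable m (\<lambda>t. b t * G (s, t)) \<longleftrightarrow> tot s < \<infinity>"
      by (simp add: integrable_iff_bounded)
    have "(\<integral>\<^sup>+t. ennreal (b t * G (s, t)) \<partial>m) = pos s" "(\<integral>\<^sup>+t. ennreal (- (b t * G (s, t))) \<partial>m) = neg s"
      unfolding pos_def neg_def using b(2)
      by (auto intro!: nn_integral_cong simp: ennreal_mult'[symmetric])
    then show ?thesis
      using int by (auto simp: real_lebesgue_integral_def not_integrable_integral_eq)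
  qed
  then show ?thesis by simp
qed

text \<open>Measurability at every point, not merely almost everywhere: the measure is not completed, so
  this is what makes a convolution a representative of a class. Writing \<open>b = norm b * sgn b\<close>
  moves the phase of \<open>b\<close> into the second factor and leaves an integral against a positive finite
  measure.\<close>
lemma borel_measurable_convolution:
  assumes b: "integrable m b" and f[measurable]: "f \<in> borel_measurable borel"
  shows "convolution m b f \<in> borel_measurable borel"
proof -
  have b_meas[measurable]: "b \<in> borel_measurable borel" using b by (auto dest: borel_measurable_integrable)
  have bn: "integrable m (\<lambda>t. norm (b t))" using b by simp
  let ?G = "\<lambda>p. sgn (b (snd p)) * f (- snd p + fst p)"
  have [measurable]: "?G \<in> borel_measurable borel"
    by (auto simp: sgn_div_norm)
  define tot where "tot s = (\<integral>\<^sup>+t. ennreal (norm (b t)) * ennreal (norm (f (- t + s))) \<partial>m)" for s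
  have [measurable]: "tot \<in> borel_measurable borel"
    unfolding tot_def using borel_measurable_integral_section[OF bn, of "\<lambda>p. ennreal (norm (f (- snd p + fst p)))"] by simp
  define re where "re s = (LINT t|m. norm (b t) * Re (?G (s, t)))" for s
  define im where "im s = (LINT t|m. norm (b t) * Im (?G (s, t)))" for s
  have [measurable]: "re \<in> borel_measurable borel" "im \<in> borel_measurable borel"
    unfolding re_def im_def
    by (rule borel_measurable_lebesgue_section[OF bn], simp, simp)+
  have polar: "b t * f (- t + s) = complex_of_real (norm (b t)) * ?G (s, t)" for s t
    by (cases "b t = 0") (auto simp: sgn_div_norm scaleR_conv_of_real divide_inverse)
  have "convolution m b f s = (if tot s < \<infinity> then Complex (re s) (im s) else 0)" for s
  proof -
    have "(\<integral>\<^sup>+t. ennreal (norm (b t * f (- t + s))) \<partial>m) = tot s"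
      unfolding tot_def by (intro nn_integral_cong) (simp add: norm_mult ennreal_mult)
    moreover have "(\<lambda>t. b t * f (- t + s)) \<in> borel_measurable m" by simp
    ultimately have int: "integrable m (\<lambda>t. b t * f (- t + s)) \<longleftrightarrow> tot s < \<infinity>"
      by (simp add: integrable_iff_bounded)
    show ?thesis
    proof (cases "tot s < \<infinity>")
      case True
      then have i: "integrable m (\<lambda>t. b t * f (- t + s))" using int by simp
      have "Re (convolution m b f s) = (LINT t|m. Re (b t * f (- t + s)))"
        unfolding convolution_def using integral_Re[OF i] by simp
      moreover have "Im (convolution m b f s) = (LINT t|m. Im (b t * f (- t + s)))"
        unfolding convolution_def using integral_Im[OF i] by simp
      ultimately show ?thesis using True
        unfolding polar re_def im_def by (simp add: complex_eq_iff)
    qed (use int in \<open>simp add: convolution_def not_integrable_integral_eq\<close>)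
  qed
  then have "convolution m b f = (\<lambda>s. if tot s < \<infinity> then Complex (re s) (im s) else 0)" by blast
  moreover have "(\<lambda>s. Complex (re s) (im s)) \<in> borel_measurable borel"
    unfolding Complex_eq by measurable
  ultimately show ?thesis by simp
qed

lemma convolution_norm_inequality:
  assumes b: "integrable m b" and f: "integrable m f" and k[measurable]: "k \<in> borel_measurable borel"
  shows "(\<integral>\<^sup>+s. k s * ennreal (norm (convolution m b f s)) \<partial>m)
       \<le> (\<integral>\<^sup>+t. ennreal (norm (b t)) * (\<integral>\<^sup>+s. k (t + s) * ennreal (norm (f s)) \<partial>m) \<partial>m)"
proof -
  have le: "ennreal (norm (convolution m b f s)) \<le> (\<integral>\<^sup>+t. ennreal (norm (b t)) * ennreal (norm (f (- t + s))) \<partial>m)" for s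
  proof (cases "integrable m (\<lambda>t. b t * f (- t + s))")
    case True
    from integral_norm_bound_ennreal[OF this] show ?thesis
      unfolding convolution_def by (simp add: norm_mult ennreal_mult)
  qed (simp add: convolution_def not_integrable_integral_eq)
  have "(\<integral>\<^sup>+s. k s * ennreal (norm (convolution m b f s)) \<partial>m)
      \<le> (\<integral>\<^sup>+s. k s * (\<integral>\<^sup>+t. ennreal (norm (b t)) * ennreal (norm (f (- t + s))) \<partial>m) \<partial>m)"
    using le by (intro nn_integral_mono mult_left_mono) auto
  also have "\<dots> \<le> (\<integral>\<^sup>+t. ennreal (norm (b t)) * (\<integral>\<^sup>+s. k (t + s) * ennreal (norm (f s)) \<partial>m) \<partial>m)"
    using b f by (intro convolution_inequality k) auto
  finally show ?thesis .
qed

text \<open>Changing \<open>f\<close> on a null set changes the integrand of the convolution at \<open>s\<close> only for \<open>t\<close> in a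
  reflected null set, so the convolution does not change at any point.\<close>
lemma convolution_cong_AE:
  assumes b: "integrable m b" "integrable m b'" and f: "f \<in> borel_measurable borel" "f' \<in> borel_measurable borel"
    and bb: "AE t in m. b t = b' t" and ff: "AE t in m. f t = f' t"
  shows "convolution m b f = convolution m b' f'"
proof
  fix s
  have [measurable]: "b \<in> borel_measurable borel" "b' \<in> borel_measurable borel"
    "f \<in> borel_measurable borel" "f' \<in> borel_measurable borel"
    using b f by (auto dest: borel_measurable_integrable)
  define N where "N = {x. f x \<noteq> f' x}"
  have N: "N \<in> sets borel" unfolding N_def by measurable
  have N0: "emeasure m N = 0"
    using ff N by (subst (asm) AE_iff_measurable[of N]) (auto simp: N_def)
  have bn: "integrable m (\<lambda>t. norm (b t))" using b by simp
  have "AE t in m. norm (b t) \<noteq> 0 \<longrightarrow> - t + s \<notin> N"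
    by (rule null_set_reflected[OF N N0 bn]) simp
  with bb have "AE t in m. b t * f (- t + s) = b' t * f' (- t + s)"
    by eventually_elim (auto simp: N_def)
  then show "convolution m b f s = convolution m b' f' s"
    unfolding convolution_def by (intro integral_cong_AE) auto
qed

end

section \<open>The weighted convolution algebra\<close>

locale weighted_haar_group = haar_group m for m :: "'g::{topological_group_add, t2_space} measure" +
  fixes \<omega> :: "'g \<Rightarrow> real"
  assumes weight: "weight \<omega>"
begin

lemma weight_measurable [measurable]: "\<omega> \<in> borel_measurable borel"
  using weight by (simp add: weight_def)

lemma weight_ge_1: "1 \<le> \<omega> u"
  using weight by (simp add: weight_def)

lemma weight_submult: "\<omega> (u + v) \<le> \<omega> u * \<omega> v"
  using weight by (simp add: weight_def)

lemma L1w_funs_D: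
  assumes "f \<in> L1w_funs m \<omega>"
  shows "integrable m f" "f \<in> borel_measurable borel" "(\<integral>\<^sup>+t. ennreal (norm (f t)) \<partial>m) < \<infinity>"
    "(\<integral>\<^sup>+t. ennreal (norm (f t)) * ennreal (\<omega> t) \<partial>m) < \<infinity>"
proof -
  show f: "integrable m f" using assms by (simp add: L1w_funs_def)
  then show "f \<in> borel_measurable borel" by (auto dest: borel_measurable_integrable)
  show "(\<integral>\<^sup>+t. ennreal (norm (f t)) \<partial>m) < \<infinity>" using f by (simp add: integrable_iff_bounded)
  have "integrable m (\<lambda>t. norm (f t) * \<omega> t)" using assms by (simp add: L1w_funs_def)
  then have "(\<integral>\<^sup>+t. ennreal (norm (norm (f t) * \<omega> t)) \<partial>m) < \<infinity>" by (simp add: integrable_iff_bounded)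
  moreover have "\<omega> t \<ge> 0" for t using weight_ge_1[of t] by simp
  then have "(\<lambda>t. ennreal (norm (norm (f t) * \<omega> t))) = (\<lambda>t. ennreal (norm (f t)) * ennreal (\<omega> t))"
    by (auto simp: fun_eq_iff abs_mult ennreal_mult')
  ultimately show "(\<integral>\<^sup>+t. ennreal (norm (f t)) * ennreal (\<omega> t) \<partial>m) < \<infinity>" by simp
qed

lemma L1w_funs_I:
  assumes f[measurable]: "f \<in> borel_measurable borel"
    and fin: "(\<integral>\<^sup>+t. ennreal (norm (f t)) * ennreal (\<omega> t) \<partial>m) < \<infinity>"
  shows "f \<in> L1w_funs m \<omega>"
proof -
  have w0: "\<omega> t \<ge> 0" for t using weight_ge_1[of t] by simp
  have "(\<integral>\<^sup>+t. ennreal (norm (f t)) \<partial>m) \<le> (\<integral>\<^sup>+t. ennreal (norm (f t)) * ennreal (\<omega> t) \<partial>m)"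
  proof (rule nn_integral_mono)
    fix t
    have "norm (f t) * 1 \<le> norm (f t) * \<omega> t" using weight_ge_1 by (intro mult_left_mono) auto
    then show "ennreal (norm (f t)) \<le> ennreal (norm (f t)) * ennreal (\<omega> t)"
      by (simp add: ennreal_mult'[symmetric] ennreal_leI)
  qed
  also have "\<dots> < \<infinity>" by (rule fin)
  finally have 1: "integrable m f" by (simp add: integrable_iff_bounded)
  have "(\<lambda>t. ennreal (norm (norm (f t) * \<omega> t))) = (\<lambda>t. ennreal (norm (f t)) * ennreal (\<omega> t))"
    using w0 by (auto simp: fun_eq_iff abs_mult ennreal_mult')
  then have 2: "integrable m (\<lambda>t. norm (f t) * \<omega> t)"
    using fin by (simp add: integrable_iff_bounded)
  show ?thesis using 1 2 by (simp add: L1w_funs_def)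
qed

lemma zero_L1w_funs: "(\<lambda>t. 0) \<in> L1w_funs m \<omega>"
  by (simp add: L1w_funs_def)

lemma add_L1w_funs:
  assumes f: "f \<in> L1w_funs m \<omega>" and g: "g \<in> L1w_funs m \<omega>"
  shows "(\<lambda>t. f t + g t) \<in> L1w_funs m \<omega>"
proof (rule L1w_funs_I)
  have [measurable]: "f \<in> borel_measurable borel" "g \<in> borel_measurable borel" using L1w_funs_D f g by auto
  show "(\<lambda>t. f t + g t) \<in> borel_measurable borel" by simp
  have "(\<integral>\<^sup>+t. ennreal (norm (f t + g t)) * ennreal (\<omega> t) \<partial>m)
      \<le> (\<integral>\<^sup>+t. ennreal (norm (f t)) * ennreal (\<omega> t) + ennreal (norm (g t)) * ennreal (\<omega> t) \<partial>m)"
    by (intro nn_integral_mono)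
      (simp add: distrib_right[symmetric] ennreal_plus[symmetric] norm_triangle_ineq ennreal_leI mult_right_mono
        del: ennreal_plus)
  also have "\<dots> = (\<integral>\<^sup>+t. ennreal (norm (f t)) * ennreal (\<omega> t) \<partial>m) + (\<integral>\<^sup>+t. ennreal (norm (g t)) * ennreal (\<omega> t) \<partial>m)"
    by (rule nn_integral_add) auto
  also have "\<dots> < \<infinity>" using L1w_funs_D f g by simp
  finally show "(\<integral>\<^sup>+t. ennreal (norm (f t + g t)) * ennreal (\<omega> t) \<partial>m) < \<infinity>" .
qed

lemma scale_L1w_funs: "f \<in> L1w_funs m \<omega> \<Longrightarrow> (\<lambda>t. c * f t) \<in> L1w_funs m \<omega>"
  by (simp add: L1w_funs_def norm_mult mult.assoc)

text \<open>Since \<open>\<omega> (t + s) \<le> \<omega> t * \<omega> s\<close>, the inequality for convolutions with \<open>k = \<omega>\<close> bounds the weighted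
  norm of the convolution by the product of the weighted norms.\<close>
lemma convolution_L1w_funs:
  assumes b: "b \<in> L1w_funs m \<omega>" and f: "f \<in> L1w_funs m \<omega>"
  shows "convolution m b f \<in> L1w_funs m \<omega>"
proof (rule L1w_funs_I)
  have [measurable]: "f \<in> borel_measurable borel" "b \<in> borel_measurable borel" using L1w_funs_D f b by auto
  show "convolution m b f \<in> borel_measurable borel"
    by (intro borel_measurable_convolution L1w_funs_D b f)
  have "(\<integral>\<^sup>+s. ennreal (norm (convolution m b f s)) * ennreal (\<omega> s) \<partial>m)
     \<le> (\<integral>\<^sup>+t. ennreal (norm (b t)) * (\<integral>\<^sup>+s. ennreal (\<omega> (t + s)) * ennreal (norm (f s)) \<partial>m) \<partial>m)"
    using convolution_norm_inequality[of b f "\<lambda>s. ennreal (\<omega> s)"] L1w_funs_D(1) b f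
    by (simp add: mult.commute)
  also have "\<dots> \<le> (\<integral>\<^sup>+t. ennreal (norm (b t)) * (\<integral>\<^sup>+s. ennreal (\<omega> t) * (ennreal (norm (f s)) * ennreal (\<omega> s)) \<partial>m) \<partial>m)"
  proof (intro nn_integral_mono mult_left_mono)
    fix t s
    have "0 \<le> \<omega> t" "0 \<le> \<omega> s" using weight_ge_1[of t] weight_ge_1[of s] by auto
    then have "ennreal (\<omega> (t + s)) \<le> ennreal (\<omega> t) * ennreal (\<omega> s)"
      using weight_submult[of t s] by (simp add: ennreal_mult[symmetric] ennreal_leI)
    then have "ennreal (\<omega> (t + s)) * ennreal (norm (f s)) \<le> (ennreal (\<omega> t) * ennreal (\<omega> s)) * ennreal (norm (f s))"
      by (rule mult_right_mono) simp
    then show "ennreal (\<omega> (t + s)) * ennreal (norm (f s)) \<le> ennreal (\<omega> t) * (ennreal (norm (f s)) * ennreal (\<omega> s))"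
      by (simp add: mult_ac)
  qed auto
  also have "\<dots> = (\<integral>\<^sup>+t. (ennreal (norm (b t)) * ennreal (\<omega> t)) * (\<integral>\<^sup>+s. ennreal (norm (f s)) * ennreal (\<omega> s) \<partial>m) \<partial>m)"
    by (simp add: nn_integral_cmult mult.assoc)
  also have "\<dots> = (\<integral>\<^sup>+t. ennreal (norm (b t)) * ennreal (\<omega> t) \<partial>m) * (\<integral>\<^sup>+s. ennreal (norm (f s)) * ennreal (\<omega> s) \<partial>m)"
    by (rule nn_integral_multc) auto
  also have "\<dots> < \<infinity>" using L1w_funs_D b f by (simp add: ennreal_mult_less_top)
  finally show "(\<integral>\<^sup>+s. ennreal (norm (convolution m b f s)) * ennreal (\<omega> s) \<partial>m) < \<infinity>" .
qed

abbreviation cls :: "('g \<Rightarrow> complex) \<Rightarrow> ('g \<Rightarrow> complex) set" where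
  "cls f \<equiv> L1w_rel m \<omega> `` {f}"

lemma equiv_L1w_rel: "equiv (L1w_funs m \<omega>) (L1w_rel m \<omega>)"
proof (rule equivI)
  show "L1w_rel m \<omega> \<subseteq> L1w_funs m \<omega> \<times> L1w_funs m \<omega>" by (auto simp: L1w_rel_def)
  show "refl_on (L1w_funs m \<omega>) (L1w_rel m \<omega>)" by (auto simp: L1w_rel_def refl_on_def)
  show "sym (L1w_rel m \<omega>)" by (auto simp: L1w_rel_def sym_def eq_commute)
  show "trans (L1w_rel m \<omega>)" by (auto simp: L1w_rel_def trans_def elim: AE_mp)
qed

lemma cls_eqI: "f \<in> L1w_funs m \<omega> \<Longrightarrow> g \<in> L1w_funs m \<omega> \<Longrightarrow> AE t in m. f t = g t \<Longrightarrow> cls f = cls g"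
  by (rule equiv_class_eq[OF equiv_L1w_rel]) (simp add: L1w_rel_def)

lemma cls_eqD: "f \<in> L1w_funs m \<omega> \<Longrightarrow> g \<in> L1w_funs m \<omega> \<Longrightarrow> cls f = cls g \<Longrightarrow> AE t in m. f t = g t"
  using eq_equiv_class[OF _ equiv_L1w_rel, of f g] by (simp add: L1w_rel_def)

lemma carr_L1w: "carr (L1w m \<omega>) = cls ` L1w_funs m \<omega>"
  by (auto simp: L1w_def quotient_def)

lemma zer_L1w: "zer (L1w m \<omega>) = cls (\<lambda>t. 0)"
  by (simp add: L1w_def)

lemma add_cls:
  assumes "f \<in> L1w_funs m \<omega>" "g \<in> L1w_funs m \<omega>"
  shows "add (L1w m \<omega>) (cls f) (cls g) = cls (\<lambda>t. f t + g t)"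
proof -
  have "congruent2 (L1w_rel m \<omega>) (L1w_rel m \<omega>) (\<lambda>f g. cls (\<lambda>t. f t + g t))"
    by (rule congruent2I') (auto simp: L1w_rel_def intro!: cls_eqI add_L1w_funs elim: AE_mp)
  from UN_equiv_class2[OF equiv_L1w_rel equiv_L1w_rel this assms] show ?thesis by (simp add: L1w_def)
qed

lemma scale_cls:
  assumes "f \<in> L1w_funs m \<omega>"
  shows "scale (L1w m \<omega>) c (cls f) = cls (\<lambda>t. c * f t)"
proof -
  have "congruent (L1w_rel m \<omega>) (\<lambda>f. cls (\<lambda>t. c * f t))"
    by (rule congruentI) (auto simp: L1w_rel_def intro!: cls_eqI scale_L1w_funs)
  from UN_equiv_class[OF equiv_L1w_rel this assms] show ?thesis by (simp add: L1w_def)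
qed

lemma mul_cls:
  assumes "b \<in> L1w_funs m \<omega>" "f \<in> L1w_funs m \<omega>"
  shows "mul (L1w m \<omega>) (cls b) (cls f) = cls (convolution m b f)"
proof -
  have "congruent2 (L1w_rel m \<omega>) (L1w_rel m \<omega>) (\<lambda>b f. cls (convolution m b f))"
  proof (rule congruent2I')
    fix b b' f f' assume "(b, b') \<in> L1w_rel m \<omega>" "(f, f') \<in> L1w_rel m \<omega>"
    then have "convolution m b f = convolution m b' f'"
      by (intro convolution_cong_AE) (auto simp: L1w_rel_def dest: L1w_funs_D)
    then show "cls (convolution m b f) = cls (convolution m b' f')" by simp
  qed
  from UN_equiv_class2[OF equiv_L1w_rel equiv_L1w_rel this assms] show ?thesis by (simp add: L1w_def)
qed

section \<open>Left ideals defined by a rate of uniform integrability\<close>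

text \<open>The bound depends on \<open>E\<close> through its measure alone, which makes the condition invariant under left
  translation.\<close>
definition dominated :: "(ennreal \<Rightarrow> ennreal) \<Rightarrow> ('g \<Rightarrow> complex) \<Rightarrow> bool" where
  "dominated \<phi> f \<longleftrightarrow> (\<exists>C<\<infinity>. \<forall>E\<in>sets borel.
     (\<integral>\<^sup>+x. indicator E x * ennreal (norm (f x)) \<partial>m) \<le> C * \<phi> (emeasure m E))"

definition dominated_ideal :: "(ennreal \<Rightarrow> ennreal) \<Rightarrow> ('g \<Rightarrow> complex) set set" where
  "dominated_ideal \<phi> = cls ` {f \<in> L1w_funs m \<omega>. dominated \<phi> f}"

lemma dominated_add:
  assumes "dominated \<phi> f" "dominated \<phi> g" and [measurable]: "f \<in> borel_measurable borel" "g \<in> borel_measurable borel"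
  shows "dominated \<phi> (\<lambda>t. f t + g t)"
proof -
  obtain C D where C: "C < \<infinity>" "\<And>E. E \<in> sets borel \<Longrightarrow>
      (\<integral>\<^sup>+x. indicator E x * ennreal (norm (f x)) \<partial>m) \<le> C * \<phi> (emeasure m E)"
    and D: "D < \<infinity>" "\<And>E. E \<in> sets borel \<Longrightarrow>
      (\<integral>\<^sup>+x. indicator E x * ennreal (norm (g x)) \<partial>m) \<le> D * \<phi> (emeasure m E)"
    using assms(1,2) unfolding dominated_def by meson
  show ?thesis unfolding dominated_def
  proof (intro exI[of _ "C + D"] conjI ballI)
    fix E :: "'g set" assume E[measurable]: "E \<in> sets borel"
    have "(\<integral>\<^sup>+x. indicator E x * ennreal (norm (f x + g x)) \<partial>m)
        \<le> (\<integral>\<^sup>+x. indicator E x * ennreal (norm (f x)) + indicator E x * ennreal (norm (g x)) \<partial>m)"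
      by (intro nn_integral_mono)
        (simp add: distrib_left[symmetric] ennreal_plus[symmetric] norm_triangle_ineq ennreal_leI mult_left_mono
          del: ennreal_plus)
    also have "\<dots> = (\<integral>\<^sup>+x. indicator E x * ennreal (norm (f x)) \<partial>m) + (\<integral>\<^sup>+x. indicator E x * ennreal (norm (g x)) \<partial>m)"
      by (rule nn_integral_add) auto
    also have "\<dots> \<le> (C + D) * \<phi> (emeasure m E)"
      unfolding distrib_right by (intro add_mono C D E)
    finally show "(\<integral>\<^sup>+x. indicator E x * ennreal (norm (f x + g x)) \<partial>m) \<le> (C + D) * \<phi> (emeasure m E)" .
  qed (use C D in simp)
qed

lemma dominated_scale:
  assumes "dominated \<phi> f" and [measurable]: "f \<in> borel_measurable borel"
  shows "dominated \<phi> (\<lambda>t. c * f t)"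
proof -
  obtain C where C: "C < \<infinity>" "\<And>E. E \<in> sets borel \<Longrightarrow>
      (\<integral>\<^sup>+x. indicator E x * ennreal (norm (f x)) \<partial>m) \<le> C * \<phi> (emeasure m E)"
    using assms(1) unfolding dominated_def by meson
  show ?thesis unfolding dominated_def
  proof (intro exI[of _ "ennreal (norm c) * C"] conjI ballI)
    fix E :: "'g set" assume E[measurable]: "E \<in> sets borel"
    have "(\<integral>\<^sup>+x. indicator E x * ennreal (norm (c * f x)) \<partial>m)
        = (\<integral>\<^sup>+x. ennreal (norm c) * (indicator E x * ennreal (norm (f x))) \<partial>m)"
      by (simp add: norm_mult ennreal_mult mult_ac)
    also have "\<dots> = ennreal (norm c) * (\<integral>\<^sup>+x. indicator E x * ennreal (norm (f x)) \<partial>m)"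
      by (rule nn_integral_cmult) auto
    also have "\<dots> \<le> ennreal (norm c) * (C * \<phi> (emeasure m E))"
      by (intro mult_left_mono C E) auto
    finally show "(\<integral>\<^sup>+x. indicator E x * ennreal (norm (c * f x)) \<partial>m) \<le> ennreal (norm c) * C * \<phi> (emeasure m E)"
      by (simp add: mult.assoc)
  qed (use C in \<open>simp add: ennreal_mult_less_top\<close>)
qed

text \<open>The mass of \<open>b * f\<close> on \<open>E\<close> is at most an average, with total weight the \<open>L\<^sup>1\<close>-norm of \<open>b\<close>, of the
  masses of \<open>f\<close> on left translates of \<open>E\<close>, all of which have the measure of \<open>E\<close>.\<close>
lemma dominated_convolution:
  assumes b: "integrable m b" and f: "integrable m f" and dom: "dominated \<phi> f"
  shows "dominated \<phi> (convolution m b f)"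
proof -
  have [measurable]: "b \<in> borel_measurable borel" using b by (auto dest: borel_measurable_integrable)
  obtain C where C: "C < \<infinity>" "\<And>E. E \<in> sets borel \<Longrightarrow>
      (\<integral>\<^sup>+x. indicator E x * ennreal (norm (f x)) \<partial>m) \<le> C * \<phi> (emeasure m E)"
    using dom unfolding dominated_def by meson
  define B where "B = (\<integral>\<^sup>+t. ennreal (norm (b t)) \<partial>m)"
  have B: "B < \<infinity>" using b by (simp add: B_def integrable_iff_bounded)
  show ?thesis unfolding dominated_def
  proof (intro exI[of _ "B * C"] conjI ballI)
    fix E :: "'g set" assume E[measurable]: "E \<in> sets borel"
    have "(\<integral>\<^sup>+x. indicator E x * ennreal (norm (convolution m b f x)) \<partial>m)
        \<le> (\<integral>\<^sup>+t. ennreal (norm (b t)) * (\<integral>\<^sup>+s. indicator E (t + s) * ennreal (norm (f s)) \<partial>m) \<partial>m)"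
      by (intro convolution_norm_inequality b f) simp
    also have "\<dots> \<le> (\<integral>\<^sup>+t. ennreal (norm (b t)) * (C * \<phi> (emeasure m E)) \<partial>m)"
    proof (intro nn_integral_mono mult_left_mono)
      fix t
      have Et: "(\<lambda>s. t + s) -` E \<in> sets borel"
        using measurable_sets[OF measurable_translate(1) E] by simp
      show "(\<integral>\<^sup>+s. indicator E (t + s) * ennreal (norm (f s)) \<partial>m) \<le> C * \<phi> (emeasure m E)"
        using C(2)[OF Et] emeasure_translate[OF E, of t]
        by (simp add: indicator_vimage[symmetric] indicator_def)
    qed auto
    also have "\<dots> = B * C * \<phi> (emeasure m E)"
      unfolding B_def mult.assoc by (rule nn_integral_multc) simp
    finally show "(\<integral>\<^sup>+x. indicator E x * ennreal (norm (convolution m b f x)) \<partial>m) \<le> B * C * \<phi> (emeasure m E)" .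
  qed (use B C in \<open>simp add: ennreal_mult_less_top\<close>)
qed

lemma left_ideal_dominated_ideal: "left_ideal (L1w m \<omega>) (dominated_ideal \<phi>)"
  unfolding left_ideal_def
proof (intro conjI ballI allI)
  show "dominated_ideal \<phi> \<subseteq> carr (L1w m \<omega>)" by (auto simp: dominated_ideal_def carr_L1w)
  have "dominated \<phi> (\<lambda>t. 0)" unfolding dominated_def by (intro exI[of _ 0]) simp
  then show "zer (L1w m \<omega>) \<in> dominated_ideal \<phi>"
    using zero_L1w_funs by (auto simp: dominated_ideal_def zer_L1w)
next
  fix x y assume "x \<in> dominated_ideal \<phi>" "y \<in> dominated_ideal \<phi>"
  then obtain f g where "x = cls f" "y = cls g" "f \<in> L1w_funs m \<omega>" "g \<in> L1w_funs m \<omega>" "dominated \<phi> f" "dominated \<phi> g"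
    by (auto simp: dominated_ideal_def)
  then show "add (L1w m \<omega>) x y \<in> dominated_ideal \<phi>"
    by (auto simp: dominated_ideal_def add_cls intro!: add_L1w_funs dominated_add L1w_funs_D(2))
next
  fix c x assume "x \<in> dominated_ideal \<phi>"
  then obtain f where "x = cls f" "f \<in> L1w_funs m \<omega>" "dominated \<phi> f" by (auto simp: dominated_ideal_def)
  then show "scale (L1w m \<omega>) c x \<in> dominated_ideal \<phi>"
    by (auto simp: dominated_ideal_def scale_cls intro!: scale_L1w_funs dominated_scale L1w_funs_D(2))
next
  fix a x assume "a \<in> carr (L1w m \<omega>)" "x \<in> dominated_ideal \<phi>"
  then obtain b f where "a = cls b" "x = cls f" "b \<in> L1w_funs m \<omega>" "f \<in> L1w_funs m \<omega>" "dominated \<phi> f"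
    by (auto simp: dominated_ideal_def carr_L1w)
  then show "mul (L1w m \<omega>) a x \<in> dominated_ideal \<phi>"
    by (auto simp: dominated_ideal_def mul_cls intro!: convolution_L1w_funs dominated_convolution L1w_funs_D(1))
qed

end

section \<open>Dominated ideals are proper\<close>

text \<open>Convergence of \<open>\<phi>\<close> to \<open>0\<close> at \<open>0\<close>, including the value \<open>0\<close> at \<open>0\<close> itself.\<close>
definition vanishing :: "(ennreal \<Rightarrow> ennreal) \<Rightarrow> bool" where
  "vanishing \<phi> \<longleftrightarrow> (\<forall>e>0. \<exists>d>0. \<forall>\<delta>\<le>ennreal d. \<phi> \<delta> \<le> ennreal e)"

lemma vanishing_add:
  assumes "vanishing \<phi>" "vanishing \<psi>"
  shows "vanishing (\<lambda>\<delta>. \<phi> \<delta> + \<psi> \<delta>)"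
  unfolding vanishing_def
proof (intro allI impI)
  fix e :: real assume e: "e > 0"
  obtain d1 where d1: "d1 > 0" "\<And>\<delta>. \<delta> \<le> ennreal d1 \<Longrightarrow> \<phi> \<delta> \<le> ennreal (e / 2)"
    using assms(1)[unfolded vanishing_def, rule_format, of "e / 2"] e by auto
  obtain d2 where d2: "d2 > 0" "\<And>\<delta>. \<delta> \<le> ennreal d2 \<Longrightarrow> \<psi> \<delta> \<le> ennreal (e / 2)"
    using assms(2)[unfolded vanishing_def, rule_format, of "e / 2"] e by auto
  have "\<phi> \<delta> + \<psi> \<delta> \<le> ennreal e" if "\<delta> \<le> ennreal (min d1 d2)" for \<delta>
  proof -
    have "\<delta> \<le> ennreal d1" "\<delta> \<le> ennreal d2"
      using that by (auto intro: order_trans[OF _ ennreal_leI])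
    then have "\<phi> \<delta> + \<psi> \<delta> \<le> ennreal (e / 2) + ennreal (e / 2)"
      using d1 d2 by (simp add: add_mono)
    also have "\<dots> = ennreal e" using e by (subst ennreal_plus[symmetric]) auto
    finally show ?thesis .
  qed
  then show "\<exists>d>0. \<forall>\<delta>\<le>ennreal d. \<phi> \<delta> + \<psi> \<delta> \<le> ennreal e"
    using d1(1) d2(1) by (intro exI[of _ "min d1 d2"]) auto
qed

lemma vanishing_sum:
  assumes "finite I" "\<And>i. i \<in> I \<Longrightarrow> vanishing (\<phi> i)"
  shows "vanishing (\<lambda>\<delta>. \<Sum>i\<in>I. \<phi> i \<delta>)"
  using assms
proof (induction I rule: finite_induct)
  case empty
  then show ?case by (auto simp: vanishing_def intro: exI[of _ 1])
next
  case (insert i I)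
  then show ?case by (simp add: vanishing_add)
qed

text \<open>In a non-discrete group points are null: a neighbourhood of finite measure is infinite, and all
  its points have the same measure. Outer regularity at \<open>{0}\<close> then provides small neighbourhoods,
  which are not null.\<close>
lemma (in haar_group) small_sets_in_compact:
  assumes nondiscrete: "(euclidean :: 'g topology) \<noteq> discrete_topology UNIV"
  shows "\<exists>K. compact K \<and> (\<forall>d>0. \<exists>E\<in>sets borel. E \<subseteq> K \<and> 0 < emeasure m E \<and> emeasure m E \<le> ennreal d)"
proof -
  obtain U K :: "'g set" where UK: "open U" "0 \<in> U" "compact K" "U \<subseteq> K"
    using compact_neighbourhood by blast
  have [measurable]: "U \<in> sets borel" "K \<in> sets borel" using UK by auto
  have fin: "emeasure m U < \<infinity>"
    using emeasure_mono[OF UK(4), of m] emeasure_compact[OF UK(3)] by (auto intro: le_less_trans)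
  have sing: "{x} \<in> sets borel" for x :: 'g by (intro borel_closed) auto
  have sing_eq: "emeasure m {x} = emeasure m {0}" for x
  proof -
    have "(\<lambda>y. x + y) -` {x} = {0}"
    proof (intro equalityI subsetI)
      fix y assume "y \<in> (\<lambda>y. x + y) -` {x}"
      then have "x + y = x + 0" by simp
      then show "y \<in> {0}" by (simp only: add_left_cancel) simp
    qed simp
    then show ?thesis using emeasure_translate[OF sing, of x x] by simp
  qed
  have "infinite U"
  proof
    assume "finite U"
    then have "open (U - (U - {0}))"
      using UK(1) by (intro open_Diff finite_imp_closed) auto
    also have "U - (U - {0}) = {0}" using UK(2) by auto
    finally have "open {0 :: 'g}" .
    then have "open ((\<lambda>y. - x + y) -` {0 :: 'g})" for x :: 'g by (rule open_translate)
    moreover have "(\<lambda>y. - x + y) -` {0 :: 'g} = {x}" for x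
    proof (intro equalityI subsetI)
      fix y assume "y \<in> (\<lambda>y. - x + y) -` {0 :: 'g}"
      then have "x + (- x + y) = x" by simp
      then show "y \<in> {x}" by (simp add: add.assoc[symmetric])
    qed auto
    ultimately have "open {x :: 'g}" for x by metis
    then have "discrete_topology UNIV = (euclidean :: 'g topology)"
      by (subst discrete_topology_unique) (auto simp: open_openin[symmetric])
    with nondiscrete show False by simp
  qed
  have "emeasure m {0} = 0"
  proof (rule ccontr)
    assume c: "emeasure m {0} \<noteq> 0"
    have ub: "of_nat n * emeasure m {0} \<le> emeasure m U" for n
    proof -
      obtain F where F: "F \<subseteq> U" "finite F" "card F = n"
        using infinite_arbitrarily_large[OF \<open>infinite U\<close>] by blast
      have "emeasure m F = (\<Sum>x\<in>F. emeasure m {x})"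
        using F(2) sing by (intro emeasure_eq_sum_singleton) auto
      also have "\<dots> = (\<Sum>x\<in>F. emeasure m {0})" by (intro sum.cong refl sing_eq)
      also have "\<dots> = of_nat n * emeasure m {0}" using F(3) by simp
      finally have "of_nat n * emeasure m {0} = emeasure m F" by simp
      also have "\<dots> \<le> emeasure m U" using F(1) by (intro emeasure_mono) auto
      finally show ?thesis .
    qed
    have "emeasure m {0} \<le> emeasure m U" using ub[of 1] by simp
    with fin have "emeasure m {0} < top" by (auto intro: le_less_trans)
    then obtain a where a: "emeasure m {0} = ennreal a" "a > 0"
      using c by (cases "emeasure m {0}") (auto simp: less_le)
    obtain v where v: "emeasure m U = ennreal v" "v \<ge> 0" using fin by (cases "emeasure m U") auto
    obtain n :: nat where "v / a < n" using reals_Archimedean2 by blast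
    then have "v < real n * a" using a by (simp add: field_simps)
    moreover have "ennreal (real n * a) \<le> ennreal v"
      using ub[of n] a v by (simp add: ennreal_of_nat_eq_real_of_nat ennreal_mult'')
    ultimately show False using v a by (simp add: ennreal_le_iff)
  qed
  then have small: "\<exists>V. open V \<and> {0} \<subseteq> V \<and> emeasure m V \<le> ennreal d" if "d > 0" for d
    using outer_regular[OF sing[of 0] _ that] by simp
  have "\<exists>E\<in>sets borel. E \<subseteq> K \<and> 0 < emeasure m E \<and> emeasure m E \<le> ennreal d" if d: "d > 0" for d
  proof -
    obtain V where V: "open V" "{0} \<subseteq> V" "emeasure m V \<le> ennreal d" using small[OF d] by blast
    have "emeasure m (U \<inter> V) \<le> ennreal d"
      using V by (intro order_trans[OF emeasure_mono V(3)]) auto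
    moreover have "0 < emeasure m (U \<inter> V)"
      using UK V by (intro emeasure_open_pos open_Int) auto
    ultimately show ?thesis using UK V by (intro bexI[of _ "U \<inter> V"]) auto
  qed
  then show ?thesis using UK(3) by blast
qed

context haar_group
begin

text \<open>The modulus of absolute continuity of the indefinite integral of \<open>f\<close>.\<close>
definition modulus :: "('g \<Rightarrow> complex) \<Rightarrow> ennreal \<Rightarrow> ennreal" where
  "modulus f \<delta> = (SUP E\<in>{E\<in>sets borel. emeasure m E \<le> \<delta>}. \<integral>\<^sup>+x. indicator E x * ennreal (norm (f x)) \<partial>m)"

lemma modulus_upper:
  "E \<in> sets borel \<Longrightarrow> (\<integral>\<^sup>+x. indicator E x * ennreal (norm (f x)) \<partial>m) \<le> modulus f (emeasure m E)"
  unfolding modulus_def by (intro SUP_upper) auto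

text \<open>Split \<open>f\<close> at a large level \<open>R\<close>: the part above \<open>R\<close> has small norm by dominated convergence, and
  the part below contributes at most \<open>R * m E\<close>.\<close>
lemma vanishing_modulus:
  assumes f: "integrable m f"
  shows "vanishing (modulus f)"
  unfolding vanishing_def
proof (intro allI impI)
  fix e :: real assume e: "e > 0"
  have [measurable]: "f \<in> borel_measurable borel" using f by (auto dest: borel_measurable_integrable)
  define T where "T n x = indicator {x. real n < norm (f x)} x * ennreal (norm (f x))" for n x
  have T_meas[measurable]: "T n \<in> borel_measurable borel" for n unfolding T_def by measurable
  have "(\<lambda>n. \<integral>\<^sup>+x. T n x \<partial>m) \<longlonglongrightarrow> (\<integral>\<^sup>+x. 0 \<partial>m)"
  proof (rule nn_integral_dominated_convergence[where w = "\<lambda>x. ennreal (norm (f x))"])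
    show "AE x in m. (\<lambda>n. T n x) \<longlonglongrightarrow> 0"
    proof (rule AE_I2)
      fix x
      obtain N :: nat where N: "norm (f x) < N" using reals_Archimedean2 by blast
      have "eventually (\<lambda>n. T n x = 0) sequentially"
        using eventually_ge_at_top[of N] by eventually_elim (use N in \<open>auto simp: T_def indicator_def\<close>)
      then show "(\<lambda>n. T n x) \<longlonglongrightarrow> 0" by (rule tendsto_eventually)
    qed
  qed (use f in \<open>auto simp: integrable_iff_bounded T_def indicator_def\<close>)
  then have "eventually (\<lambda>n. (\<integral>\<^sup>+x. T n x \<partial>m) < ennreal (e / 2)) sequentially"
    using e by (intro order_tendstoD(2)) auto
  then obtain R :: nat where R: "(\<integral>\<^sup>+x. T R x \<partial>m) < ennreal (e / 2)"
    by (auto simp: eventually_sequentially)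
  define d where "d = e / (2 * (real R + 1))"
  have d: "d > 0" using e by (simp add: d_def)
  have "modulus f \<delta> \<le> ennreal e" if \<delta>: "\<delta> \<le> ennreal d" for \<delta>
    unfolding modulus_def
  proof (rule SUP_least)
    fix E assume "E \<in> {E \<in> sets borel. emeasure m E \<le> \<delta>}"
    then have E[measurable]: "E \<in> sets borel" and small: "emeasure m E \<le> ennreal d" using \<delta> by auto
    have "(\<integral>\<^sup>+x. indicator E x * ennreal (norm (f x)) \<partial>m) \<le> (\<integral>\<^sup>+x. ennreal (real R) * indicator E x + T R x \<partial>m)"
      by (intro nn_integral_mono) (auto simp: T_def indicator_def intro!: ennreal_leI simp del: ennreal_of_nat_eq_real_of_nat)
    also have "\<dots> = ennreal (real R) * emeasure m E + (\<integral>\<^sup>+x. T R x \<partial>m)"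
      by (subst nn_integral_add) (auto simp: nn_integral_cmult_indicator)
    also have "\<dots> \<le> ennreal (real R) * ennreal d + ennreal (e / 2)"
      using R small by (intro add_mono mult_left_mono) auto
    also have "\<dots> = ennreal (real R * d + e / 2)"
      using e d by (simp add: ennreal_mult''[symmetric] ennreal_plus[symmetric] del: ennreal_plus)
    also have "\<dots> \<le> ennreal e"
    proof (rule ennreal_leI)
      have "real R * d \<le> (real R + 1) * d" using d by (intro mult_right_mono) auto
      also have "\<dots> = e / 2" by (simp add: d_def field_simps)
      finally show "real R * d + e / 2 \<le> e" by simp
    qed
    finally show "(\<integral>\<^sup>+x. indicator E x * ennreal (norm (f x)) \<partial>m) \<le> ennreal e" .
  qed
  then show "\<exists>d>0. \<forall>\<delta>\<le>ennreal d. modulus f \<delta> \<le> ennreal e" using d by blast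
qed

end

context weighted_haar_group
begin

text \<open>A gliding hump. Choose sets \<open>E n\<close> of positive measure, inside a compact set on which the weight is
  bounded, so small that \<open>\<phi> (m (E n)) \<le> (1/4)^n\<close>, and put mass \<open>(1/2)^n\<close> uniformly on each \<open>E n\<close>.
  The sum has finite weighted norm, but \<open>(1/2)^n \<le> C * (1/4)^n\<close> fails for large \<open>n\<close>, whatever \<open>C\<close>.\<close>
lemma dominated_ideal_proper:
  assumes nondiscrete: "(euclidean :: 'g topology) \<noteq> discrete_topology UNIV"
    and van: "vanishing \<phi>"
  shows "dominated_ideal \<phi> \<noteq> carr (L1w m \<omega>)"
proof -
  obtain K :: "'g set" where K: "compact K"
    "\<And>d. d > 0 \<Longrightarrow> \<exists>E\<in>sets borel. E \<subseteq> K \<and> 0 < emeasure m E \<and> emeasure m E \<le> ennreal d"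
    using small_sets_in_compact[OF nondiscrete] by blast
  have "\<exists>E\<in>sets borel. E \<subseteq> K \<and> 0 < emeasure m E \<and> emeasure m E < \<infinity> \<and> \<phi> (emeasure m E) \<le> ennreal ((1/4)^n)" for n :: nat
  proof -
    obtain d where d: "d > 0" "\<And>\<delta>. \<delta> \<le> ennreal d \<Longrightarrow> \<phi> \<delta> \<le> ennreal ((1/4)^n)"
      using van[unfolded vanishing_def, rule_format, of "(1/4)^n"] by auto
    obtain E where E: "E \<in> sets borel" "E \<subseteq> K" "0 < emeasure m E" "emeasure m E \<le> ennreal d"
      using K(2)[OF d(1)] by blast
    then show ?thesis using d(2)[OF E(4)] by (intro bexI[of _ E]) (auto intro: le_less_trans)
  qed
  then obtain E where E: "\<And>n. E n \<in> sets borel" "\<And>n. E n \<subseteq> K" "\<And>n. 0 < emeasure m (E n)"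
    "\<And>n. emeasure m (E n) < \<infinity>" "\<And>n. \<phi> (emeasure m (E n)) \<le> ennreal ((1/4)^n)" by metis
  have [measurable]: "E n \<in> sets borel" for n by (rule E)
  define c where "c n = measure m (E n)" for n
  have c: "emeasure m (E n) = ennreal (c n)" for n
    unfolding c_def by (rule emeasure_eq_ennreal_measure) (use E(4)[of n] in simp)
  have c_pos: "c n > 0" for n using E(3)[of n] unfolding c by simp
  define a where "a x = (\<Sum>n. ennreal ((1/2)^n / c n) * indicator (E n) x)" for x
  have [measurable]: "a \<in> borel_measurable borel" unfolding a_def by measurable
  have mass: "(\<integral>\<^sup>+x. ennreal ((1/2)^n / c n) * indicator (E n) x \<partial>m) = ennreal ((1/2)^n)" for n
  proof -
    have "(\<integral>\<^sup>+x. ennreal ((1/2)^n / c n) * indicator (E n) x \<partial>m) = ennreal ((1/2)^n / c n) * ennreal (c n)"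
      by (subst nn_integral_cmult_indicator) (auto simp: c)
    also have "\<dots> = ennreal ((1/2)^n)"
      using c_pos[of n] by (subst ennreal_mult[symmetric]) auto
    finally show ?thesis .
  qed
  have "(\<integral>\<^sup>+x. a x \<partial>m) = (\<Sum>n. ennreal ((1/2)^n))"
    unfolding a_def by (subst nn_integral_suminf) (auto simp: mass)
  also have "\<dots> < \<infinity>"
    by (subst suminf_ennreal2) auto
  finally have a_fin: "(\<integral>\<^sup>+x. a x \<partial>m) < \<infinity>" .
  define g where "g x = complex_of_real (enn2real (a x))" for x
  have [measurable]: "g \<in> borel_measurable borel" unfolding g_def by measurable
  have "AE x in m. a x \<noteq> \<infinity>"
    using a_fin by (intro nn_integral_PInf_AE) auto
  then have g_eq: "AE x in m. ennreal (norm (g x)) = a x"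
    by eventually_elim (auto simp: g_def less_top)
  have "bounded (\<omega> ` K)" using weight K(1) by (simp add: weight_def)
  then obtain M where M: "\<And>x. x \<in> K \<Longrightarrow> norm (\<omega> x) \<le> M" by (auto simp: bounded_iff)
  have g: "g \<in> L1w_funs m \<omega>"
  proof (rule L1w_funs_I)
    have "(\<integral>\<^sup>+x. ennreal (norm (g x)) * ennreal (\<omega> x) \<partial>m) \<le> (\<integral>\<^sup>+x. ennreal M * a x \<partial>m)"
    proof (rule nn_integral_mono_AE, use g_eq in eventually_elim)
      fix x assume gx: "ennreal (norm (g x)) = a x"
      show "ennreal (norm (g x)) * ennreal (\<omega> x) \<le> ennreal M * a x"
      proof (cases "x \<in> K")
        case True
        then have "\<omega> x \<le> M" using M[of x] by simp
        then show ?thesis unfolding gx by (subst mult.commute) (intro mult_right_mono ennreal_leI, auto)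
      next
        case False
        then have "indicator (E n) x = (0::ennreal)" for n using E(2) by (auto simp: indicator_def)
        then show ?thesis unfolding gx by (simp add: a_def)
      qed
    qed
    also have "\<dots> = ennreal M * (\<integral>\<^sup>+x. a x \<partial>m)" by (rule nn_integral_cmult) auto
    also have "\<dots> < \<infinity>" using a_fin by (simp add: ennreal_mult_less_top)
    finally show "(\<integral>\<^sup>+x. ennreal (norm (g x)) * ennreal (\<omega> x) \<partial>m) < \<infinity>" .
  qed simp
  have "cls g \<notin> dominated_ideal \<phi>"
  proof
    assume "cls g \<in> dominated_ideal \<phi>"
    then obtain f where f: "f \<in> L1w_funs m \<omega>" "dominated \<phi> f" "cls g = cls f" by (auto simp: dominated_ideal_def)
    have fg: "AE x in m. g x = f x" using cls_eqD[OF g f(1,3)] .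
    obtain C where C: "C < \<infinity>" "\<And>E. E \<in> sets borel \<Longrightarrow>
        (\<integral>\<^sup>+x. indicator E x * ennreal (norm (f x)) \<partial>m) \<le> C * \<phi> (emeasure m E)"
      using f(2) unfolding dominated_def by meson
    obtain r where r: "C = ennreal r" "r \<ge> 0" using C(1) by (cases C) auto
    obtain n where n: "r < 2 ^ n" using real_arch_pow[of 2 r] by auto
    have "ennreal ((1/2)^n) = (\<integral>\<^sup>+x. ennreal ((1/2)^n / c n) * indicator (E n) x \<partial>m)"
      by (simp add: mass)
    also have "\<dots> \<le> (\<integral>\<^sup>+x. indicator (E n) x * ennreal (norm (f x)) \<partial>m)"
    proof (rule nn_integral_mono_AE, use g_eq fg in eventually_elim)
      fix x assume x: "ennreal (norm (g x)) = a x" "g x = f x"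
      have "ennreal ((1/2)^n / c n) * indicator (E n) x \<le> a x"
      proof -
        define t where "t k = ennreal ((1/2)^k / c k) * indicator (E k) x" for k
        have "sum t {n} \<le> suminf t" by (rule sum_le_suminf) auto
        then have "t n \<le> suminf t" by simp
        then show ?thesis unfolding t_def a_def .
      qed
      then show "ennreal ((1/2)^n / c n) * indicator (E n) x \<le> indicator (E n) x * ennreal (norm (f x))"
        using x by (auto simp: indicator_def)
    qed
    also have "\<dots> \<le> C * \<phi> (emeasure m (E n))" by (rule C(2)) simp
    also have "\<dots> \<le> ennreal r * ennreal ((1/4)^n)" unfolding r(1) by (intro mult_left_mono E) auto
    also have "\<dots> = ennreal (r * (1/4)^n)" using r(2) by (simp add: ennreal_mult)
    finally have "(1/2)^n \<le> r * (1/4)^n" using r(2) by (simp add: ennreal_le_iff)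
    then have "(1/2)^n * 4^n \<le> r * (1/4)^n * (4::real)^n" by (intro mult_right_mono) auto
    then have "2 ^ n \<le> r" by (simp add: mult.assoc power_mult_distrib[symmetric])
    with n show False by simp
  qed
  moreover have "cls g \<in> carr (L1w m \<omega>)" using g by (simp add: carr_L1w)
  ultimately show ?thesis by blast
qed

text \<open>Finitely many integrable functions share a vanishing rate, namely the sum of their moduli. In
  particular the whole algebra is not finitely generated as a left ideal.\<close>
theorem finite_subset_in_proper_left_ideal:
  assumes nondiscrete: "(euclidean :: 'g topology) \<noteq> discrete_topology UNIV"
    and Y: "finite Y" "Y \<subseteq> carr (L1w m \<omega>)"
  shows "\<exists>J. left_ideal (L1w m \<omega>) J \<and> J \<noteq> carr (L1w m \<omega>) \<and> Y \<subseteq> J"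
proof -
  have "\<forall>X\<in>Y. \<exists>f. f \<in> L1w_funs m \<omega> \<and> X = cls f"
    using Y(2) by (auto simp: carr_L1w)
  then obtain f where f: "\<And>X. X \<in> Y \<Longrightarrow> f X \<in> L1w_funs m \<omega>" "\<And>X. X \<in> Y \<Longrightarrow> X = cls (f X)"
    by metis
  define \<phi> where "\<phi> \<delta> = (\<Sum>X\<in>Y. modulus (f X) \<delta>)" for \<delta>
  have van: "vanishing \<phi>"
    unfolding \<phi>_def by (intro vanishing_sum Y(1) vanishing_modulus L1w_funs_D(1) f)
  have "dominated \<phi> (f X)" if X: "X \<in> Y" for X
    unfolding dominated_def
  proof (intro exI[of _ 1] conjI ballI)
    fix E :: "'g set" assume "E \<in> sets borel"
    then have "(\<integral>\<^sup>+x. indicator E x * ennreal (norm (f X x)) \<partial>m) \<le> modulus (f X) (emeasure m E)"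
      by (rule modulus_upper)
    also have "\<dots> \<le> \<phi> (emeasure m E)"
      unfolding \<phi>_def using X Y(1) by (intro member_le_sum) auto
    finally show "(\<integral>\<^sup>+x. indicator E x * ennreal (norm (f X x)) \<partial>m) \<le> 1 * \<phi> (emeasure m E)" by simp
  qed simp
  then have "Y \<subseteq> dominated_ideal \<phi>"
    using f unfolding dominated_ideal_def by blast
  then show ?thesis
    using left_ideal_dominated_ideal dominated_ideal_proper[OF nondiscrete van] by blast
qed

end

section \<open>Finitely generated left ideals\<close>

lemma alg_sum_in_left_ideal:
  assumes "left_ideal A J" "\<And>i. i < n \<Longrightarrow> z i \<in> J"
  shows "alg_sum A z n \<in> J"
  using assms(2)
proof (induction n)
  case 0
  then show ?case using assms(1) by (simp add: left_ideal_def)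
next
  case (Suc n)
  then show ?case using assms(1) by (simp add: left_ideal_def)
qed

lemma cu_mul_in_left_ideal:
  assumes "left_ideal A J" "x \<in> J" "u \<in> cond_unitisation A"
  shows "cu_mul A u x \<in> J"
proof -
  have "fst u \<in> carr A" using assms(3) by (auto simp: cond_unitisation_def split: if_splits)
  then show ?thesis using assms(1,2) unfolding cu_mul_def left_ideal_def by blast
qed

lemma finitely_generated_imp_finite_generators:
  assumes "finitely_generated A I"
  shows "\<exists>Y. finite Y \<and> Y \<subseteq> carr A \<and> (\<forall>J. left_ideal A J \<longrightarrow> Y \<subseteq> J \<longrightarrow> I \<subseteq> J)"
proof -
  obtain n and x :: "nat \<Rightarrow> 'a" where x: "\<forall>i<n. x i \<in> carr A"
    "I = {alg_sum A (\<lambda>i. cu_mul A (u i) (x i)) n | u. \<forall>i<n. u i \<in> cond_unitisation A}"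
    using assms unfolding finitely_generated_def by blast
  have "I \<subseteq> J" if "left_ideal A J" "x ` {..<n} \<subseteq> J" for J
    unfolding x(2) using that by (auto intro!: alg_sum_in_left_ideal cu_mul_in_left_ideal)
  with x(1) show ?thesis by (intro exI[of _ "x ` {..<n}"]) auto
qed

lemma finite_codimension_imp_finite_complement:
  assumes "finite_codimension A I"
  shows "\<exists>B. finite B \<and> B \<subseteq> carr A \<and> (\<forall>J. left_ideal A J \<longrightarrow> I \<subseteq> J \<longrightarrow> B \<subseteq> J \<longrightarrow> J = carr A)"
proof -
  obtain n and b :: "nat \<Rightarrow> 'a" where b: "\<forall>i<n. b i \<in> carr A"
    "\<forall>a\<in>carr A. \<exists>x\<in>I. \<exists>c. a = add A x (alg_sum A (\<lambda>i. scale A (c i) (b i)) n)"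
    using assms unfolding finite_codimension_def by blast
  have "J = carr A" if J: "left_ideal A J" "I \<subseteq> J" "b ` {..<n} \<subseteq> J" for J
  proof (intro equalityI subsetI)
    fix a assume "a \<in> carr A"
    then obtain x c where x: "x \<in> I" "a = add A x (alg_sum A (\<lambda>i. scale A (c i) (b i)) n)"
      using b(2) by blast
    have "scale A (c i) (b i) \<in> J" if "i < n" for i
      using J(1,3) that by (auto simp: left_ideal_def)
    then have "alg_sum A (\<lambda>i. scale A (c i) (b i)) n \<in> J"
      by (rule alg_sum_in_left_ideal[OF J(1)])
    moreover have "\<forall>x\<in>J. \<forall>y\<in>J. add A x y \<in> J" using J(1) by (simp add: left_ideal_def)
    ultimately show "a \<in> J" using x J(2) by blast
  qed (use J(1) in \<open>auto simp: left_ideal_def\<close>)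
  with b(1) show ?thesis by (intro exI[of _ "b ` {..<n}"]) auto
qed

text \<open>In both cases finitely many elements could be added to the generators of \<open>I\<close> so that no proper
  left ideal contains all of them: one element outside \<open>I\<close> when \<open>I\<close> is maximal, and elements
  spanning the quotient by \<open>I\<close> when \<open>I\<close> has finite codimension.\<close>
theorem theorem3p2:
  fixes m :: "'g::{topological_group_add, t2_space} measure"
    and \<omega> :: "'g \<Rightarrow> real"
  assumes "locally_compact_space (euclidean :: 'g topology)"
    and "(euclidean :: 'g topology) \<noteq> discrete_topology UNIV"
    and "left_haar_measure m"
    and "weight \<omega>"
  shows "(\<nexists>I. finitely_generated (L1w m \<omega>) I \<and> closedin (norm_topology (L1w m \<omega>)) I \<and>
              maximal_left_ideal (L1w m \<omega>) I) \<and>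
         (\<nexists>I. left_ideal (L1w m \<omega>) I \<and> finitely_generated (L1w m \<omega>) I \<and>
              closedin (norm_topology (L1w m \<omega>)) I \<and> finite_codimension (L1w m \<omega>) I)"
proof -
  interpret weighted_haar_group m \<omega>
    by (intro weighted_haar_group.intro haar_group.intro weighted_haar_group_axioms.intro) (fact assms)+
  let ?A = "L1w m \<omega>"
  note proper = finite_subset_in_proper_left_ideal[OF assms(2)]
  have maximal: False if fg: "finitely_generated ?A I" and max: "maximal_left_ideal ?A I" for I
  proof -
    obtain Y where Y: "finite Y" "Y \<subseteq> carr ?A" "\<forall>J. left_ideal ?A J \<longrightarrow> Y \<subseteq> J \<longrightarrow> I \<subseteq> J"
      using finitely_generated_imp_finite_generators[OF fg] by blast
    have "I \<subseteq> carr ?A" "I \<noteq> carr ?A"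
      using max by (simp_all add: maximal_left_ideal_def left_ideal_def)
    then obtain a where a: "a \<in> carr ?A" "a \<notin> I" by blast
    obtain J where J: "left_ideal ?A J" "J \<noteq> carr ?A" "insert a Y \<subseteq> J"
      using proper[of "insert a Y"] Y(1,2) a(1) by auto
    have "I \<subseteq> J" using Y(3) J by simp
    then have "J = I \<or> J = carr ?A" using max J(1) by (simp add: maximal_left_ideal_def)
    with J(2,3) a(2) show False by blast
  qed
  have codim: False if fg: "finitely_generated ?A I" and cod: "finite_codimension ?A I" for I
  proof -
    obtain Y where Y: "finite Y" "Y \<subseteq> carr ?A" "\<forall>J. left_ideal ?A J \<longrightarrow> Y \<subseteq> J \<longrightarrow> I \<subseteq> J"
      using finitely_generated_imp_finite_generators[OF fg] by blast
    obtain B where B: "finite B" "B \<subseteq> carr ?A"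
      "\<forall>J. left_ideal ?A J \<longrightarrow> I \<subseteq> J \<longrightarrow> B \<subseteq> J \<longrightarrow> J = carr ?A"
      using finite_codimension_imp_finite_complement[OF cod] by blast
    obtain J where J: "left_ideal ?A J" "J \<noteq> carr ?A" "Y \<union> B \<subseteq> J"
      using proper[of "Y \<union> B"] Y(1,2) B(1,2) by auto
    have "I \<subseteq> J" using Y(3) J by simp
    then show False using B(3) J by simp
  qed
  show ?thesis using maximal codim by blast
qed

end
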